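(* Let $d\ge 2$. Suppose the observation is $Y_1=X_1+\varepsilon_1\in\mathbb{R}^d$, where $X_1=C^{\star}+R^{\star}S(U_1)$ with $C^{\star}\in\mathbb{R}^d$, $R^{\star}\ge 0$, $U_1$ a random vector in $[0,1]^{d-1}$ with density $f^{\star}$, and $\varepsilon_1$ independent of $U_1$ with distribution $\mathbb{Q}^{\star}$. Assume (H1) and (H2). Then for any $\mathbb{Q}=\otimes_{j=1}^d\mathbb{Q}_j$ (with $\mathbb{Q}_j$ probability distributions on $\mathbb{R}$), any probability density $f$ on $[0,1]^{d-1}$, any $C\in\mathbb{R}^d$ and any $R\ge0$, we have $\mathbb{P}_{C,R,f,\mathbb{Q}}=\mathbb{P}_{C^{\star},R^{\star},f^{\star},\mathbb{Q}^{\star}}$ if and only if $R=R^{\star}$, $f=f^{\star}$, and there exists $m\in\mathbb{R}^d$ such that $C=C^{\star}+m$ and $\mathbb{Q}(\cdot)=\mathbb{Q}^{\star}(\cdot+m)$. If moreover $\mathbb{Q}$ and $\mathbb{Q}^{\star}$ have finite first moment and are centered, then $m=0$, i.e. $C=C^{\star}$ and $\mathbb{Q}=\mathbb{Q}^{\star}$.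
   Context: For $u=(u^{(1)},\dots,u^{(d-1)})\in[0,1]^{d-1}$, $S(u)\in\mathbb{R}^d$ is the point of the unit sphere with coordinates $S(u)^{(1)}=\cos(2\pi u^{(1)})$, $S(u)^{(2)}=\sin(2\pi u^{(1)})\cos(\pi u^{(2)})$, $S(u)^{(3)}=\sin(2\pi u^{(1)})\sin(\pi u^{(2)})\cos(\pi u^{(3)})$, ..., $S(u)^{(d-1)}=\sin(2\pi u^{(1)})\sin(\pi u^{(2)})\cdots\sin(\pi u^{(d-2)})\cos(\pi u^{(d-1)})$, $S(u)^{(d)}=\sin(2\pi u^{(1)})\sin(\pi u^{(2)})\cdots\sin(\pi u^{(d-2)})\sin(\pi u^{(d-1)})$ (for $d=2$, $S(u)=(\cos 2\pi u,\sin 2\pi u)$). (H1): the coordinates $\varepsilon_1^{(1)},\dots,\varepsilon_1^{(d)}$ of the noise are independent, so $\mathbb{Q}^{\star}=\otimes_{j=1}^d\mathbb{Q}^{\star}_j$ with $\mathbb{Q}^{\star}_j$ the law of $\varepsilon_1^{(j)}$. (H2): $U_1$ has a density $f^{\star}$ with respect to Lebesgue measure on $[0,1]^{d-1}$, and when $d>2$, $f^{\star}$ is positive on $(0,\gamma)^{d-1}$ for some $\gamma>0$. For a product distribution $\mathbb{Q}$ on $\mathbb{R}^d$, a probability density $f$ on $[0,1]^{d-1}$, $C\in\mathbb{R}^d$ and $R\ge0$, $\mathbb{P}_{C,R,f,\mathbb{Q}}$ denotes the law of $C+RS(U)+\varepsilon$ where $U$ has density $f$ and $\varepsilon\sim\mathbb{Q}$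 is independent of $U$.
   Formalization: The radius R* is assumed strictly positive instead of R* ≥ 0, because for R* = 0 the law does not depend on f, so R = 0, C = C*, Q = Q* with any density f ≠ f* is a counterexample; f = f* is read as equality almost everywhere. *)

theory Defs
  imports "HOL-Probability.Probability"
begin

text \<open>Points of R^n are represented as functions nat => real, restricted to the index
  set {..<n} (the space of the product measure PiM {..<n}). Indices are 0-based:
  coordinate j of the paper corresponds to index j-1 here.\<close>

definition sph_angle :: "(nat \<Rightarrow> real) \<Rightarrow> nat \<Rightarrow> real" where
  "sph_angle u i = (if i = 0 then 2 * pi * u 0 else pi * u i)"

definition sph :: "nat \<Rightarrow> (nat \<Rightarrow> real) \<Rightarrow> (nat \<Rightarrow> real)" where
  "sph d u = restrict (\<lambda>j. (\<Prod>i<j. sin (sph_angle u i)) *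
                            (if j < d - 1 then cos (sph_angle u j) else 1)) {..<d}"

definition lebn :: "nat \<Rightarrow> (nat \<Rightarrow> real) measure" where
  "lebn n = (\<Pi>\<^sub>M i\<in>{..<n}. lborel)"

definition cube :: "nat \<Rightarrow> real \<Rightarrow> real \<Rightarrow> (nat \<Rightarrow> real) set" where
  "cube n a b = (\<Pi>\<^sub>E i\<in>{..<n}. {a..b})"

definition is_density :: "nat \<Rightarrow> ((nat \<Rightarrow> real) \<Rightarrow> real) \<Rightarrow> bool" where
  "is_density n f \<longleftrightarrow>
     (\<lambda>u. f u * indicator (cube n 0 1) u) \<in> borel_measurable (lebn n) \<and>
     (\<forall>u\<in>cube n 0 1. 0 \<le> f u) \<and>
     (\<integral>\<^sup>+ u. ennreal (f u * indicator (cube n 0 1) u) \<partial>lebn n) = 1"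

definition U_law :: "nat \<Rightarrow> ((nat \<Rightarrow> real) \<Rightarrow> real) \<Rightarrow> (nat \<Rightarrow> real) measure" where
  "U_law n f = density (lebn n) (\<lambda>u. ennreal (f u * indicator (cube n 0 1) u))"

definition Rd :: "nat \<Rightarrow> (nat \<Rightarrow> real) measure" where
  "Rd d = (\<Pi>\<^sub>M j\<in>{..<d}. (borel :: real measure))"

definition model_law :: "nat \<Rightarrow> (nat \<Rightarrow> real) \<Rightarrow> real \<Rightarrow> ((nat \<Rightarrow> real) \<Rightarrow> real)
                          \<Rightarrow> (nat \<Rightarrow> real) measure \<Rightarrow> (nat \<Rightarrow> real) measure" where
  "model_law d C R f Q =
     distr (U_law (d - 1) f \<Otimes>\<^sub>M Q) (Rd d)
       (\<lambda>(u, e). restrict (\<lambda>j. C j + R * sph d u j + e j) {..<d})"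

text \<open>Q shifted: the measure A |-> Q(A + m).\<close>
definition shift_measure :: "nat \<Rightarrow> (nat \<Rightarrow> real) \<Rightarrow> (nat \<Rightarrow> real) measure \<Rightarrow> (nat \<Rightarrow> real) measure" where
  "shift_measure d m Q = distr Q (Rd d) (\<lambda>x. restrict (\<lambda>j. x j - m j) {..<d})"

end

theory Submission
  imports Defs "HOL-Complex_Analysis.Complex_Analysis"
begin

text \<open>
  Write \<open>X = R S(U)\<close>, and let \<open>\<phi>\<close> be the characteristic function of \<open>X\<close>, which is entire on
  \<open>\<complex>\<^sup>d\<close>, with marginals \<open>\<phi>\<^sub>j\<close>. Since the noise has independent coordinates, equality of the laws of the
  observations gives, near the origin and hence on all of \<open>\<complex>\<^sup>d\<close>,
  \<open>\<phi>(t) \<Prod>\<^sub>j \<phi>\<^sub>j\<^sup>*(t\<^sub>j) = \<phi>\<^sup>*(t) \<Prod>\<^sub>j \<phi>\<^sub>j(t\<^sub>j)\<close>, an identity without the noise. Because \<open>X\<close> lives on a sphere and has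
  a density there, \<open>\<phi>\<close> does not vanish identically on any hyperplane \<open>t\<^sub>j = z\<close>; therefore \<open>\<phi>\<^sub>j\<close> and
  \<open>\<phi>\<^sub>j\<^sup>*\<close> have the same zeros. Both are of exponential type, so \<open>\<phi>\<^sub>j\<^sup>* = exp(i m\<^sub>j t) \<phi>\<^sub>j\<close>, that is, \<open>X\<^sup>*\<close>
  is distributed as \<open>X + m\<close>. Two distinct spheres meet in a null set, whence \<open>m = 0\<close> and
  \<open>R = R\<^sup>*\<close>; the densities agree because \<open>S\<close> is injective up to a null set, and the noise is recovered
  by division of characteristic functions.
\<close>

section \<open>Entire functions of exponential type\<close>

text \<open>The noise is arbitrary: its characteristic functions may vanish away from the origin and
  need not extend to complex arguments. They can be divided out only near 0, where continuity keeps
  them nonzero, and only after the marginal relations \<open>\<phi>\<^sub>j \<psi>\<^sub>j =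
  \<phi>\<^sub>j' \<psi>\<^sub>j'\<close> (with \<open>\<psi>\<close> the noise factors) have
  replaced one noise by the other. No theory of several complex variables is used: every
  continuation runs along a complex line \<open>a + z b\<close>, as a statement about entire
  functions of one variable. Equality of zeros, with multiplicity, comes from freezing all
  coordinates but one at values where the remaining factors are nonzero. Both quotients of the
  marginals are then entire, so each is zero free and has an entire logarithm, to which the growth
  bound applies. Growth alone leaves a complex exponent; the conjugate symmetry of characteristic
  functions of real variables makes it purely imaginary, so that the shift is a real vector.\<close>

lemma norm_circlepath [simp]: "r \<ge> 0 \<Longrightarrow> norm (circlepath 0 r x) = r"
  by (simp add: circlepath norm_mult)

section \<open>Taylor coefficients of entire functions as circle averages\<close>

lemma circle_coefficient_has_integral:
  assumes h: "h holomorphic_on UNIV" and r: "r > 0"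
  shows "((\<lambda>x. h (circlepath 0 r x) / circlepath 0 r x ^ n) has_integral (deriv ^^ n) h 0 / fact n) {0..1}"
proof -
  have "((\<lambda>u. h u / (u - 0) ^ Suc n) has_contour_integral (2 * pi * \<i>) / fact n * (deriv ^^ n) h 0)
      (circlepath 0 r)"
    using r h by (intro Cauchy_has_contour_integral_higher_derivative_circlepath)
      (auto intro: holomorphic_on_subset holomorphic_on_imp_continuous_on)
  then have "((\<lambda>x. h (circlepath 0 r x) / circlepath 0 r x ^ Suc n * (2 * pi * \<i> * circlepath 0 r x))
      has_integral (2 * pi * \<i>) / fact n * (deriv ^^ n) h 0) {0..1}"
    unfolding has_contour_integral_def
    by (rule has_integral_eq[rotated]) (simp add: vector_derivative_circlepath01 del: power_Suc, simp add: circlepath)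
  then have "((\<lambda>x. (h (circlepath 0 r x) / circlepath 0 r x ^ Suc n * (2 * pi * \<i> * circlepath 0 r x)) / (2 * pi * \<i>))
      has_integral ((2 * pi * \<i>) / fact n * (deriv ^^ n) h 0) / (2 * pi * \<i>)) {0..1}"
    by (rule has_integral_divide)
  moreover have "circlepath 0 r x \<noteq> 0" for x
    using r by (simp add: circlepath)
  ultimately show ?thesis
    by (simp add: field_simps)
qed

lemma circle_mean_value:
  assumes "h holomorphic_on UNIV" "r > 0"
  shows "((\<lambda>x. h (circlepath 0 r x)) has_integral h 0) {0..1}"
  using circle_coefficient_has_integral[OF assms, of 0] by simp

lemma circle_mean_value_Re:
  assumes "h holomorphic_on UNIV" "r > 0"
  shows "((\<lambda>x. Re (h (circlepath 0 r x))) has_integral Re (h 0)) {0..1}"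
  using has_integral_linear[OF circle_mean_value[OF assms] bounded_linear_Re] by (simp add: o_def)

text \<open>On the circle \<open>cnj z = r\<^sup>2 / z\<close>, so the mean of
  \<open>cnj h / z^n\<close> is, up to conjugation and a constant, the mean of \<open>h z^n\<close>,
  which is zero for \<open>n > 0\<close>. Adding this zero replaces \<open>h\<close> by
  \<open>2 Re h\<close>: only the real part has to be controlled.\<close>

lemma circle_coefficient_Re_has_integral:
  assumes h: "h holomorphic_on UNIV" and r: "r > 0" and n: "n > 0"
  shows "((\<lambda>x. 2 * complex_of_real (Re (h (circlepath 0 r x))) / circlepath 0 r x ^ n)
           has_integral (deriv ^^ n) h 0 / fact n) {0..1}"
proof -
  let ?c = "circlepath 0 r"
  have nz: "?c x \<noteq> 0" for x
    using r by (simp add: circlepath)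
  have conj: "cnj (?c x) = complex_of_real (r\<^sup>2) / ?c x" for x
    using complex_norm_square[of "?c x"] r nz[of x] by (simp add: field_simps)
  have "((\<lambda>x. h (?c x) * ?c x ^ n) has_integral h 0 * 0 ^ n) {0..1}"
    using r by (intro circle_mean_value[of "\<lambda>z. h z * z ^ n"] holomorphic_intros h) auto
  then have "((\<lambda>x. h (?c x) * ?c x ^ n) has_integral 0) {0..1}"
    using n by (simp add: zero_power)
  from has_integral_linear[OF this bounded_linear_cnj]
  have "((\<lambda>x. cnj (h (?c x)) * (complex_of_real (r\<^sup>2) / ?c x) ^ n) has_integral 0) {0..1}"
    by (simp add: o_def conj)
  from has_integral_divide[OF this, of "complex_of_real (r\<^sup>2) ^ n"]
  have "((\<lambda>x. cnj (h (?c x)) / ?c x ^ n) has_integral 0) {0..1}"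
    using r by (simp add: power_divide)
  from has_integral_add[OF circle_coefficient_has_integral[OF h r, of n] this]
  show ?thesis
    by (simp add: add_divide_distrib[symmetric] complex_add_cnj)
qed

text \<open>Splitting off both constant terms leaves a factor \<open>z * cnj z\<close>, which is
  constant on the circle; induction thus removes all mixed powers of \<open>z\<close> and
  \<open>cnj z\<close>.\<close>

lemma Re_times_cnj_poly_on_sphere:
  fixes p q :: "complex poly"
  shows "\<exists>s. \<forall>z. norm z = r \<longrightarrow> Re (poly p z * cnj (poly q z)) = Re (poly s z)"
proof (induction p arbitrary: q)
  case 0
  show ?case by (rule exI[of _ 0]) simp
next
  case (pCons a p)
  obtain b q' where q: "q = pCons b q'"
    using pCons_cases by blast
  obtain s where s: "Re (poly p z * cnj (poly q' z)) = Re (poly s z)" if "norm z = r" for z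
    using pCons.IH[of q'] by blast
  let ?s = "smult (cnj a) q + pCons 0 (smult (cnj b) p) + smult (of_real (r\<^sup>2)) s"
  show ?case
  proof (intro exI[of _ ?s] allI impI)
    fix z :: complex assume z: "norm z = r"
    have zz: "z * cnj z = of_real (r\<^sup>2)"
      using z by (metis complex_norm_square of_real_power)
    have "poly (pCons a p) z * cnj (poly q z)
        = a * cnj (poly q z) + z * poly p z * cnj b + (z * cnj z) * (poly p z * cnj (poly q' z))"
      by (simp add: q algebra_simps)
    also have "Re \<dots> = Re (cnj a * poly q z) + Re (z * poly p z * cnj b) + r\<^sup>2 * Re (poly s z)"
      unfolding zz using s[OF z] by simp
    also have "\<dots> = Re (poly ?s z)"
      by (simp add: algebra_simps)
    finally show "Re (poly (pCons a p) z * cnj (poly q z)) = Re (poly ?s z)" .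
  qed
qed

text \<open>Products stay in the class because
  \<open>Re a * Re b = (Re (a * b) + Re (a * cnj b)) / 2\<close>. The point is that real parts of
  polynomials are harmonic, unlike general polynomials in \<open>Re z\<close> and
  \<open>Im z\<close>.\<close>

lemma real_polynomial_function_on_sphere_eq_Re_poly:
  fixes g :: "complex \<Rightarrow> real"
  assumes "real_polynomial_function g"
  shows "\<exists>p. \<forall>z. norm z = r \<longrightarrow> g z = Re (poly p z)"
  using assms
proof (induction rule: real_polynomial_function.induct)
  case (linear f)
  then interpret bounded_linear f .
  show ?case
  proof (intro exI[of _ "[:0, Complex (f 1) (- f \<i>):]"] allI impI)
    fix z
    have "f z = f (Re z *\<^sub>R 1 + Im z *\<^sub>R \<i>)"
      by (simp add: scaleR_conv_of_real mult.commute complex_eq[symmetric])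
    also have "\<dots> = Re z * f 1 + Im z * f \<i>"
      by (simp only: add scale) simp
    finally show "f z = Re (poly [:0, Complex (f 1) (- f \<i>):] z)"
      by simp
  qed
next
  case (const c)
  show ?case by (rule exI[of _ "[:of_real c:]"]) simp
next
  case (add f g)
  then obtain p q where "\<forall>z. norm z = r \<longrightarrow> f z = Re (poly p z)" "\<forall>z. norm z = r \<longrightarrow> g z = Re (poly q z)"
    by auto
  then show ?case by (intro exI[of _ "p + q"]) simp
next
  case (mult f g)
  then obtain p q where pq: "\<forall>z. norm z = r \<longrightarrow> f z = Re (poly p z)" "\<forall>z. norm z = r \<longrightarrow> g z = Re (poly q z)"
    by auto
  obtain s where s: "\<forall>z. norm z = r \<longrightarrow> Re (poly p z * cnj (poly q z)) = Re (poly s z)"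
    using Re_times_cnj_poly_on_sphere by blast
  show ?case
  proof (intro exI[of _ "smult (1/2) (p * q + s)"] allI impI)
    fix z :: complex assume z: "norm z = r"
    have sz: "Re (poly s z) = Re (poly p z * cnj (poly q z))"
      using s z by metis
    have "Re (poly (smult (1/2) (p * q + s)) z) = Re (poly p z) * Re (poly q z)"
      unfolding poly_smult poly_add poly_mult by (simp add: sz)
    then show "f z * g z = Re (poly (smult (1/2) (p * q + s)) z)"
      using pq z by simp
  qed
qed

text \<open>Approximating the continuous function \<open>log |F|\<close> on the circle by the real part of a
  polynomial \<open>p\<close> reduces the inequality to the maximum modulus principle for \<open>F exp(-p)\<close>, so
  that the zeros of \<open>F\<close> inside the disc need not be divided out.\<close>

lemma Jensen_inequality_circle:
  assumes F: "F holomorphic_on UNIV" and r: "r > 0"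
    and nz: "\<And>z. norm z = r \<Longrightarrow> F z \<noteq> 0" and F0: "F 0 \<noteq> 0"
  shows "(\<lambda>x. ln (norm (F (circlepath 0 r x)))) integrable_on {0..1}" (is ?int)
    and "ln (norm (F 0)) \<le> integral {0..1} (\<lambda>x. ln (norm (F (circlepath 0 r x))))" (is ?le)
proof -
  let ?u = "\<lambda>z. ln (norm (F z))"
  have contF: "continuous_on S F" for S
    using F holomorphic_on_imp_continuous_on continuous_on_subset by blast
  have cont: "continuous_on (sphere 0 r) ?u"
    using nz by (auto intro!: continuous_intros contF)
  have "continuous_on {0..1} (\<lambda>x. ?u (circlepath 0 r x))"
    by (rule continuous_on_compose2[OF cont]) (use r in \<open>auto simp: circlepath norm_mult intro!: continuous_intros\<close>)
  then show int: ?int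
    by (rule integrable_continuous_real)
  show ?le
  proof (rule field_le_epsilon)
    fix e :: real assume e: "e > 0"
    then obtain g where g: "real_polynomial_function g" "\<And>z. z \<in> sphere 0 r \<Longrightarrow> \<bar>?u z - g z\<bar> < e / 2"
      using Stone_Weierstrass_real_polynomial_function[OF compact_sphere cont, of "e/2"] by auto
    obtain p where "\<And>z. norm z = r \<Longrightarrow> g z = Re (poly p z)"
      using real_polynomial_function_on_sphere_eq_Re_poly[OF g(1)] by blast
    with g have p: "\<bar>?u z - Re (poly p z)\<bar> < e / 2" if "norm z = r" for z
      using that by fastforce
    have polyh: "poly p holomorphic_on S" for S
      by (auto intro!: holomorphic_intros)
    let ?G = "\<lambda>z. F z * exp (- poly p z)"
    have Gh: "?G holomorphic_on UNIV"
      by (intro holomorphic_intros F)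
    have "norm (?G 0) \<le> exp (e / 2)"
    proof (rule maximum_modulus_frontier[of ?G "cball 0 r"])
      show "?G holomorphic_on interior (cball 0 r)" "continuous_on (closure (cball 0 r)) ?G"
        using Gh by (auto intro: holomorphic_on_subset holomorphic_on_imp_continuous_on)
      show "norm (?G z) \<le> exp (e / 2)" if "z \<in> frontier (cball 0 r)" for z
      proof -
        have z: "norm z = r"
          using that r by simp
        then have "norm (?G z) = exp (?u z - Re (poly p z))"
          using nz by (simp add: norm_mult exp_diff exp_minus norm_divide norm_inverse field_simps)
        moreover have "?u z - Re (poly p z) \<le> e / 2"
          using p[OF z] by linarith
        ultimately show ?thesis by simp
      qed
    qed (use r in auto)
    moreover have "norm (?G 0) = exp (?u 0 - Re (poly p 0))"
      using F0 by (simp add: norm_mult exp_diff exp_minus norm_divide norm_inverse field_simps)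
    ultimately have "?u 0 \<le> Re (poly p 0) + e / 2"
      by simp
    \<comment> \<open>\<open>Re p\<close> is harmonic, so its value at 0 is its mean over the
      circle. The second \<open>e / 2\<close> pays for returning from \<open>Re p\<close> to
      \<open>ln |F|\<close>.\<close>
    also have "\<dots> = integral {0..1} (\<lambda>x. Re (poly p (circlepath 0 r x)) + e / 2)"
      using has_integral_add[OF circle_mean_value_Re[OF polyh r] has_integral_const_real[of "e/2" 0 1]]
      by (simp add: integral_unique)
    also have "\<dots> \<le> integral {0..1} (\<lambda>x. ?u (circlepath 0 r x) + e)"
    proof (rule integral_le)
      show "(\<lambda>x. Re (poly p (circlepath 0 r x)) + e / 2) integrable_on {0..1}"
        using has_integral_add[OF circle_mean_value_Re[OF polyh r] has_integral_const_real[of "e/2" 0 1]]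
        by blast
      show "(\<lambda>x. ?u (circlepath 0 r x) + e) integrable_on {0..1}"
        using int by (intro integrable_add) auto
      show "Re (poly p (circlepath 0 r x)) + e / 2 \<le> ?u (circlepath 0 r x) + e" for x
        using p[OF norm_circlepath[of r x]] r by linarith
    qed
    also have "\<dots> = integral {0..1} (\<lambda>x. ?u (circlepath 0 r x)) + e"
      using int by (subst integral_add) auto
    finally show "?u 0 \<le> integral {0..1} (\<lambda>x. ?u (circlepath 0 r x)) + e" .
  qed
qed

section \<open>Identity theorem, cancellation and quotients of entire functions\<close>

lemma entire_mult_eq_0:
  assumes D: "D holomorphic_on UNIV" and E: "E holomorphic_on UNIV"
    and zero: "\<And>z. D z * E z = 0" and a: "E a \<noteq> 0"
  shows "D z = 0"
proof (rule analytic_continuation_open[of "{z. E z \<noteq> 0}" UNIV D "\<lambda>_. 0"])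
  have "open (E -` (- {0}))"
    using holomorphic_on_imp_continuous_on[OF E] by (intro open_vimage) auto
  then show "open {z. E z \<noteq> 0}"
    by (simp add: vimage_def)
qed (use assms in \<open>auto intro: holomorphic_intros\<close>)

text \<open>The real points accumulate at 0. Used on restrictions to complex lines, this carries
  identities from real points to complex ones.\<close>

lemma entire_eq_0_of_real_interval:
  assumes F: "F holomorphic_on UNIV" and e: "e > 0"
    and zero: "\<And>s. \<bar>s\<bar> < e \<Longrightarrow> F (complex_of_real s) = 0"
  shows "F z = 0"
proof (rule analytic_continuation[OF F, of "complex_of_real ` {-e<..<e}" 0])
  show "0 islimpt complex_of_real ` {-e<..<e}"
    unfolding islimpt_approachable
  proof (intro allI impI)
    fix d :: real assume d: "0 < d"
    have "min d e / 2 \<in> {-e<..<e}"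
      using d e by auto
    moreover have "dist (complex_of_real (min d e / 2)) 0 < d"
      using d e by (simp add: norm_divide)
    ultimately show "\<exists>x'\<in>complex_of_real ` {-e<..<e}. x' \<noteq> 0 \<and> dist x' 0 < d"
      using d e by (intro bexI[of _ "complex_of_real (min d e / 2)"] conjI imageI) (auto simp del: of_real_divide)
  qed
qed (use zero in auto)

lemma entire_eventually_nonzero:
  assumes F: "F holomorphic_on UNIV" and a: "F a \<noteq> 0"
  shows "eventually (\<lambda>x. F x \<noteq> 0) (at z)"
proof -
  have "\<not> z islimpt {x. F x = 0}"
  proof
    assume lim: "z islimpt {x. F x = 0}"
    have "F a = 0"
      by (rule analytic_continuation[OF F open_UNIV connected_UNIV _ _ lim]) simp_all
    with a show False by simp
  qed
  then show ?thesis
    by (simp add: islimpt_iff_eventually)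
qed

lemma entire_countable_zeros:
  assumes F: "F holomorphic_on UNIV" and a: "F a \<noteq> 0"
  shows "countable {z. F z = 0}"
proof (cases "F constant_on UNIV")
  case True
  then have "{z. F z = 0} = {}"
    using a by (auto simp: constant_on_def)
  then show ?thesis by simp
next
  case False
  then show ?thesis
    using holomorphic_countable_zeros[OF F open_UNIV connected_UNIV] by simp
qed

text \<open>The local condition expresses, without mentioning orders, that \<open>f\<close> vanishes
  at least as strongly as \<open>g\<close> at each point: near \<open>z0\<close> the quotient is
  \<open>H2 / H1\<close>, regular even at zeros of \<open>g\<close>. Taking \<open>w\<close> as the
  limit of \<open>f / g\<close> makes it independent of the pair, so the local quotients
  glue.\<close>

lemma entire_quotient:
  assumes f: "f holomorphic_on UNIV" and g: "g holomorphic_on UNIV" and a: "g a \<noteq> 0"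
    and loc: "\<And>z0. \<exists>H1 H2. H1 holomorphic_on UNIV \<and> H2 holomorphic_on UNIV \<and> H1 z0 \<noteq> 0 \<and>
                (\<forall>z. H1 z * f z = H2 z * g z)"
  obtains w where "w holomorphic_on UNIV" "\<And>z. f z = g z * w z"
proof -
  define w where "w z = Lim (at z) (\<lambda>x. f x / g x)" for z
  have *: "w field_differentiable (at z0) \<and> f z0 = g z0 * w z0" for z0
  proof -
    obtain H1 H2 where H: "H1 holomorphic_on UNIV" "H2 holomorphic_on UNIV" "H1 z0 \<noteq> 0"
        "\<And>z. H1 z * f z = H2 z * g z"
      using loc by blast
    have cont: "isCont H1 z" "isCont H2 z" for z
      using H by (metis UNIV_I continuous_on_eq_continuous_at holomorphic_on_imp_continuous_on open_UNIV)+
    let ?S = "{z. H1 z \<noteq> 0}"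
    have "open (H1 -` (- {0}))"
      using holomorphic_on_imp_continuous_on[OF H(1)] by (intro open_vimage) auto
    then have S: "open ?S"
      by (simp add: vimage_def)
    \<comment> \<open>Needed on the whole neighbourhood where \<open>H1\<close> is nonzero, since
      differentiability of \<open>w\<close> at \<open>z0\<close> depends on nearby values. The limit
      ignores the isolated zeros of \<open>g\<close>.\<close>
    have weq: "w z = H2 z / H1 z" if z: "z \<in> ?S" for z
    proof -
      have "eventually (\<lambda>x. f x / g x = H2 x / H1 x) (at z)"
        using entire_eventually_nonzero[OF g a, of z] eventually_at_in_open[OF S z]
      proof eventually_elim
        case (elim x)
        then show ?case using H(4)[of x] by (auto simp: frac_eq_eq mult.commute)
      qed
      moreover have "((\<lambda>x. H2 x / H1 x) \<longlongrightarrow> H2 z / H1 z) (at z)"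
        using cont z by (intro tendsto_intros) (auto simp: isCont_def)
      ultimately have "((\<lambda>x. f x / g x) \<longlongrightarrow> H2 z / H1 z) (at z)"
        by (simp add: tendsto_cong)
      then show ?thesis
        unfolding w_def by (intro tendsto_Lim) auto
    qed
    have "(\<lambda>z. H2 z / H1 z) holomorphic_on ?S"
      using H by (intro holomorphic_intros) (auto intro: holomorphic_on_subset)
    then have "w holomorphic_on ?S"
      by (rule holomorphic_transform) (use weq in auto)
    then have "w field_differentiable (at z0)"
      using S H(3) by (simp add: holomorphic_on_imp_differentiable_at)
    moreover have "f z0 = g z0 * w z0"
    proof -
      have "H1 z0 * f z0 = H1 z0 * (g z0 * w z0)"
        using weq[of z0] H(3) H(4)[of z0] by simp
      with H(3) show ?thesis by simp
    qed
    ultimately show ?thesis by blast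
  qed
  then have "w holomorphic_on UNIV"
    by (auto simp: holomorphic_on_def field_differentiable_at_within)
  with * that show thesis by blast
qed

text \<open>A weak form of Hadamard factorisation. On a circle of radius \<open>r\<close> one has
  \<open>|Re h| \<le> 4Br - ln |f g|\<close> and Jensen's inequality bounds the mean of the right-hand side
  by \<open>4Br\<close>; hence the Taylor coefficients of \<open>h\<close> of order at least 2 vanish.\<close>

lemma exponential_type_quotient_linear:
  assumes f: "f holomorphic_on UNIV" and g: "g holomorphic_on UNIV" and h: "h holomorphic_on UNIV"
    and eq: "\<And>z. f z = g z * exp (h z)"
    and fb: "\<And>z. norm (f z) \<le> exp (B * norm z)" and gb: "\<And>z. norm (g z) \<le> exp (B * norm z)"
    and f0: "f 0 = 1" and g0: "g 0 = 1" and B: "B \<ge> 0"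
  shows "h z = h 0 + deriv h 0 * z"
proof -
  let ?F = "\<lambda>z. f z * g z"
  have F: "?F holomorphic_on UNIV"
    by (intro holomorphic_intros f g)
  have cnt: "countable {z. ?F z = 0}"
    by (rule entire_countable_zeros[OF F, of 0]) (simp add: f0 g0)
  have bound: "norm ((deriv ^^ n) h 0 / fact n) \<le> 8 * B * r / r ^ n"
    if r: "r > 0" and nz: "\<And>z. norm z = r \<Longrightarrow> ?F z \<noteq> 0" and n: "n > 0" for r :: real and n
  proof -
    let ?c = "circlepath 0 r"
    let ?l = "\<lambda>x. ln (norm (?F (?c x)))"
    have J: "?l integrable_on {0..1}" "0 \<le> integral {0..1} ?l"
      using Jensen_inequality_circle[OF F r nz] f0 g0 by simp_all
    \<comment> \<open>The factor \<open>2 / r ^ n\<close> is that of the coefficient formula. As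
      \<open>ln |f|\<close> and \<open>ln |g|\<close> are at most \<open>B * r\<close> and
      \<open>Re h\<close> is their difference, the bracket dominates \<open>|Re h|\<close>.\<close>
    let ?G = "\<lambda>x. 2 / r ^ n * (4 * B * r - ?l x)"
    have Gint: "(?G has_integral (2 / r ^ n * (4 * B * r - integral {0..1} ?l))) {0..1}"
      using has_integral_mult_right[OF has_integral_diff[OF has_integral_const_real[of "4*B*r" 0 1]
              integrable_integral[OF J(1)]], of "2 / r ^ n"] by simp
    have I: "((\<lambda>x. 2 * complex_of_real (Re (h (?c x))) / ?c x ^ n) has_integral (deriv ^^ n) h 0 / fact n) {0..1}"
      by (rule circle_coefficient_Re_has_integral[OF h r n])
    have "norm (integral {0..1} (\<lambda>x. 2 * complex_of_real (Re (h (?c x))) / ?c x ^ n)) \<le> integral {0..1} ?G"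
    proof (rule integral_norm_bound_integral)
      fix x :: real
      let ?z = "?c x"
      have nr: "norm ?z = r"
        using r by simp
      have nzf: "f ?z \<noteq> 0" "g ?z \<noteq> 0"
        using nz[OF nr] by auto
      have lf: "ln (norm (f ?z)) = ln (norm (g ?z)) + Re (h ?z)"
        using nzf(2) by (simp add: eq norm_mult ln_mult)
      have "ln (norm (f ?z)) \<le> B * r" "ln (norm (g ?z)) \<le> B * r"
        using fb[of ?z] gb[of ?z] nzf nr by (metis ln_exp ln_mono norm_ge_zero zero_less_norm_iff exp_gt_zero)+
      moreover have "?l x = ln (norm (f ?z)) + ln (norm (g ?z))"
        using nzf by (simp add: norm_mult ln_mult)
      moreover have "0 \<le> B * r"
        using B r by simp
      ultimately have "\<bar>Re (h ?z)\<bar> \<le> 4 * B * r - ?l x"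
        using lf by linarith
      then show "norm (2 * complex_of_real (Re (h ?z)) / ?z ^ n) \<le> ?G x"
        using r nr by (simp add: norm_divide norm_mult norm_power divide_right_mono)
    qed (use I Gint in auto)
    then have "norm ((deriv ^^ n) h 0 / fact n) \<le> 2 / r ^ n * (4 * B * r - integral {0..1} ?l)"
      unfolding integral_unique[OF I] integral_unique[OF Gint] .
    also have "\<dots> \<le> 2 / r ^ n * (4 * B * r)"
      using J(2) r by (intro mult_left_mono) auto
    finally show ?thesis by simp
  qed
  have coeff: "(deriv ^^ n) h 0 = 0" if n: "n \<ge> 2" for n
  proof (rule ccontr)
    assume nonzero: "(deriv ^^ n) h 0 \<noteq> 0"
    let ?\<epsilon> = "norm ((deriv ^^ n) h 0 / fact n)"
    have pos: "?\<epsilon> > 0"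
      using nonzero by simp
    \<comment> \<open>The moduli of the zeros form a countable set, so some admissible circle avoids
      them. \<open>r > 1\<close> lets \<open>r ^ n\<close> be replaced by \<open>r ^ 2\<close>, and
      the second lower bound makes \<open>8 * B / r\<close> smaller than the coefficient.\<close>
    have "uncountable {max 1 (8 * B / ?\<epsilon>)<..}"
      using uncountable_open_interval[of "max 1 (8 * B / ?\<epsilon>)" "max 1 (8 * B / ?\<epsilon>) + 1"]
      by (meson countable_subset greaterThanLessThan_iff greaterThan_iff less_add_one subsetI)
    then have "\<not> {max 1 (8 * B / ?\<epsilon>)<..} \<subseteq> norm ` {z. ?F z = 0}"
      using cnt countable_subset by blast
    then obtain r where r: "r > 1" "r > 8 * B / ?\<epsilon>" and nz: "\<And>z. norm z = r \<Longrightarrow> ?F z \<noteq> 0"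
      by fastforce
    have "?\<epsilon> \<le> 8 * B * r / r ^ n"
      using r nz n by (intro bound) auto
    also have "\<dots> \<le> 8 * B * r / r ^ 2"
      using r n B by (intro divide_left_mono power_increasing mult_nonneg_nonneg mult_pos_pos zero_less_power) auto
    also have "\<dots> = 8 * B / r"
      using r by (simp add: power2_eq_square)
    also have "\<dots> < ?\<epsilon>"
      using r pos by (simp add: field_simps)
    finally show False by simp
  qed
  have "(\<lambda>n. (deriv ^^ n) h 0 / fact n * (z - 0) ^ n) sums h z"
    by (rule holomorphic_power_series[of h 0 "norm z + 1"]) (auto intro: holomorphic_on_subset[OF h])
  moreover have "(\<lambda>n. (deriv ^^ n) h 0 / fact n * (z - 0) ^ n) sums
      (\<Sum>n\<in>{0,1}. (deriv ^^ n) h 0 / fact n * (z - 0) ^ n)"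
    by (rule sums_finite) (auto intro!: coeff)
  ultimately show ?thesis
    by (auto dest: sums_unique2)
qed

section \<open>Uniqueness of Fourier transforms\<close>

text \<open>Frequency 0 gives both measures the same mass \<open>c\<close>. Dividing by
  \<open>c\<close> reduces to probability distributions, and \<open>c = 0\<close> makes both
  measures null.\<close>

lemma Levy_uniqueness_finite:
  assumes fin: "finite_measure M1" "finite_measure M2"
    and sets: "sets M1 = sets borel" "sets M2 = sets borel"
    and eq: "char M1 = char M2"
  shows "M1 = M2"
proof -
  interpret M1: finite_measure M1 by fact
  interpret M2: finite_measure M2 by fact
  have sp: "space M1 = UNIV" "space M2 = UNIV"
    using sets_eq_imp_space_eq[OF sets(1)] sets_eq_imp_space_eq[OF sets(2)] by simp_all
  define c where "c = measure M1 UNIV"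
  have "char M1 0 = of_real (measure M1 UNIV)" "char M2 0 = of_real (measure M2 UNIV)"
    by (simp_all add: char_def sp scaleR_conv_of_real)
  then have c2: "c = measure M2 UNIV"
    by (simp add: c_def eq)
  have c0: "c \<ge> 0"
    by (simp add: c_def)
  have scaled: "real_distribution (density M (\<lambda>_. ennreal (1 / c)))"
      "char (density M (\<lambda>_. ennreal (1 / c))) = (\<lambda>t. char M t / of_real c)"
      "\<And>A. A \<in> sets M \<Longrightarrow> emeasure (density M (\<lambda>_. ennreal (1 / c))) A = ennreal (measure M A / c)"
    if M: "finite_measure M" "sets M = sets borel" "measure M UNIV = c" and c: "c > 0" for M
  proof -
    interpret finite_measure M by fact
    have sp: "space M = UNIV"
      using sets_eq_imp_space_eq[OF M(2)] by simp
    have [measurable_cong]: "sets M = sets borel" by fact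
    show em: "emeasure (density M (\<lambda>_. ennreal (1 / c))) A = ennreal (measure M A / c)" if "A \<in> sets M" for A
      using that c by (simp add: emeasure_density_const emeasure_eq_measure ennreal_mult[symmetric])
    show "real_distribution (density M (\<lambda>_. ennreal (1 / c)))"
    proof (intro real_distribution.intro prob_spaceI real_distribution_axioms.intro)
      show "emeasure (density M (\<lambda>_. ennreal (1 / c))) (space (density M (\<lambda>_. ennreal (1 / c)))) = 1"
        using em[of UNIV] c M(2,3) sp by simp
    qed (simp_all add: M)
    show "char (density M (\<lambda>_. ennreal (1 / c))) = (\<lambda>t. char M t / of_real c)"
      using c by (auto simp: char_def integral_density scaleR_conv_of_real divide_inverse mult.commute)
  qed
  show ?thesis
  proof (cases "c = 0")
    case True
    have "emeasure M1 A = emeasure M2 A" for A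
      using M1.emeasure_eq_measure[of UNIV] M2.emeasure_eq_measure[of UNIV] True c2
        emeasure_mono[of A UNIV M1] emeasure_mono[of A UNIV M2] sets
      by (simp add: c_def)
    then show ?thesis
      using sets by (intro measure_eqI) auto
  next
    case False
    with c0 have c: "c > 0" by simp
    note s1 = scaled[OF fin(1) sets(1) c_def[symmetric] c]
    note s2 = scaled[OF fin(2) sets(2) c2[symmetric] c]
    have N: "density M1 (\<lambda>_. ennreal (1 / c)) = density M2 (\<lambda>_. ennreal (1 / c))"
      by (rule Levy_uniqueness[OF s1(1) s2(1)]) (simp add: s1(2) s2(2) eq)
    have "emeasure M1 A = emeasure M2 A" if A: "A \<in> sets M1" for A
    proof -
      have "ennreal (measure M1 A / c) = ennreal (measure M2 A / c)"
        using s1(3)[of A] s2(3)[of A] N A sets by simp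
      then have "measure M1 A = measure M2 A"
        using c by simp
      then show ?thesis
        by (simp add: M1.emeasure_eq_measure M2.emeasure_eq_measure)
    qed
    then show ?thesis
      using sets by (intro measure_eqI) auto
  qed
qed

lemma integral_distr_density:
  fixes G :: "'b \<Rightarrow> 'c::{banach, second_countable_topology}"
  assumes g: "integrable M g" "\<And>x. 0 \<le> g x" and [measurable]: "X \<in> M \<rightarrow>\<^sub>M N" "G \<in> borel_measurable N"
  shows "(\<integral>y. G y \<partial>distr (density M (\<lambda>x. ennreal (g x))) N X) = (\<integral>x. g x *\<^sub>R G (X x) \<partial>M)"
proof -
  have [measurable]: "g \<in> borel_measurable M"
    using g by auto
  show ?thesis
    using g by (subst integral_distr) (auto simp: integral_density)
qed

lemma finite_measure_distr_density:
  fixes g :: "'a \<Rightarrow> real"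
  assumes g: "integrable M g" "\<And>x. 0 \<le> g x" and [measurable]: "X \<in> M \<rightarrow>\<^sub>M N"
  shows "finite_measure (distr (density M (\<lambda>x. ennreal (g x))) N X)"
proof (rule finite_measure.finite_measure_distr)
  have [measurable]: "g \<in> borel_measurable M"
    using g by auto
  show "finite_measure (density M (\<lambda>x. ennreal (g x)))"
  proof (rule finite_measureI)
    have "(\<integral>\<^sup>+x. ennreal (g x) \<partial>M) < \<infinity>"
      using g by (simp add: nn_integral_eq_integral)
    then show "emeasure (density M (\<lambda>x. ennreal (g x))) (space (density M (\<lambda>x. ennreal (g x)))) \<noteq> \<infinity>"
      by (simp add: emeasure_density cong: nn_integral_cong)
  qed
qed simp

text \<open>The positive and negative parts of the weight \<open>h\<close> give two finite image
  measures under \<open>X\<close>; the hypothesis says that their characteristic functions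
  agree.\<close>

lemma Fourier_zero_indicator_real:
  fixes h X :: "'a \<Rightarrow> real"
  assumes h: "integrable M h" and X [measurable]: "X \<in> borel_measurable M"
    and zero: "\<And>t. (\<integral>x. of_real (h x) * iexp (t * X x) \<partial>M) = 0"
    and A [measurable]: "A \<in> sets borel"
  shows "(\<integral>x. h x * indicator A (X x) \<partial>M) = 0"
proof -
  have [measurable]: "h \<in> borel_measurable M"
    using h by auto
  define p n where "p x = max 0 (h x)" and "n x = max 0 (- h x)" for x
  have pint: "integrable M p" and nint: "integrable M n" and nn: "0 \<le> p x" "0 \<le> n x" for x
    using h by (auto simp: p_def [abs_def] n_def [abs_def])
  have hpn: "h x = p x - n x" for x
    by (auto simp: p_def n_def)
  let ?\<alpha> = "\<lambda>g. distr (density M (\<lambda>x. ennreal (g x))) borel X"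
  have int: "integrable M (\<lambda>x. g x *\<^sub>R iexp (t * X x))" if "integrable M g" for g :: "'a \<Rightarrow> real" and t
    by (rule Bochner_Integration.integrable_bound[OF that]) (use that in auto)
  have intA: "integrable M (\<lambda>x. g x * indicator A (X x))" if "integrable M g" for g :: "'a \<Rightarrow> real"
    by (rule Bochner_Integration.integrable_bound[OF that]) (use that in \<open>auto simp: indicator_def\<close>)
  have "?\<alpha> p = ?\<alpha> n"
  proof (rule Levy_uniqueness_finite)
    show "char (?\<alpha> p) = char (?\<alpha> n)"
    proof
      fix t
      have "(\<integral>x. p x *\<^sub>R iexp (t * X x) \<partial>M) - (\<integral>x. n x *\<^sub>R iexp (t * X x) \<partial>M)
          = (\<integral>x. p x *\<^sub>R iexp (t * X x) - n x *\<^sub>R iexp (t * X x) \<partial>M)"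
        by (rule Bochner_Integration.integral_diff[symmetric]; rule int; fact)
      also have "\<dots> = (\<integral>x. of_real (h x) * iexp (t * X x) \<partial>M)"
        by (intro Bochner_Integration.integral_cong refl)
           (simp add: scaleR_diff_left[symmetric] hpn[symmetric], simp add: scaleR_conv_of_real)
      finally show "char (?\<alpha> p) t = char (?\<alpha> n) t"
        unfolding char_def zero using pint nint nn by (simp add: integral_distr_density)
    qed
  qed (use pint nint nn in \<open>auto intro!: finite_measure_distr_density\<close>)
  then have "(\<integral>y. indicator A y \<partial>?\<alpha> p) = (\<integral>y. (indicator A y :: real) \<partial>?\<alpha> n)"
    by simp
  then have "(\<integral>x. p x * indicator A (X x) \<partial>M) = (\<integral>x. n x * indicator A (X x) \<partial>M)"
    using pint nint nn by (simp add: integral_distr_density del: Bochner_Integration.integral_indicator)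
  moreover have "(\<integral>x. p x * indicator A (X x) \<partial>M) - (\<integral>x. n x * indicator A (X x) \<partial>M)
      = (\<integral>x. p x * indicator A (X x) - n x * indicator A (X x) \<partial>M)"
    by (rule Bochner_Integration.integral_diff[symmetric]; rule intA; fact)
  moreover have "p x * indicator A (X x) - n x * indicator A (X x) = h x * indicator A (X x)" for x
    by (simp add: hpn left_diff_distrib)
  ultimately show ?thesis by simp
qed

lemma integral_complex_eq_0_iff:
  fixes h :: "'a \<Rightarrow> complex"
  assumes "integrable M h"
  shows "(\<integral>x. h x \<partial>M) = 0 \<longleftrightarrow> (\<integral>x. Re (h x) \<partial>M) = 0 \<and> (\<integral>x. Im (h x) \<partial>M) = 0"
  using assms by (simp add: complex_eq_iff)

text \<open>Conjugation together with \<open>t\<close> replaced by \<open>- t\<close> shows that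
  \<open>cnj h\<close> satisfies the same hypothesis, hence so do \<open>Re h\<close> and
  \<open>Im h\<close>.\<close>

lemma Fourier_zero_indicator:
  fixes h :: "'a \<Rightarrow> complex" and X :: "'a \<Rightarrow> real"
  assumes h: "integrable M h" and X [measurable]: "X \<in> borel_measurable M"
    and zero: "\<And>t. (\<integral>x. h x * iexp (t * X x) \<partial>M) = 0"
    and A [measurable]: "A \<in> sets borel"
  shows "(\<integral>x. h x * indicator A (X x) \<partial>M) = 0"
proof -
  have [measurable]: "h \<in> borel_measurable M"
    using h by auto
  have int: "integrable M (\<lambda>x. k x * iexp (t * X x))" if "integrable M k" for k :: "'a \<Rightarrow> complex" and t
    by (rule Bochner_Integration.integrable_bound[OF that]) (use that in \<open>auto simp: norm_mult\<close>)
  have hc: "integrable M (\<lambda>x. cnj (h x))"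
    using h by simp
  have cnjz: "(\<integral>x. cnj (h x) * iexp (t * X x) \<partial>M) = 0" for t
  proof -
    have "(\<integral>x. cnj (h x) * iexp (t * X x) \<partial>M) = (\<integral>x. cnj (h x * iexp (- t * X x)) \<partial>M)"
      by (intro Bochner_Integration.integral_cong refl) (simp add: exp_cnj)
    also have "\<dots> = cnj (\<integral>x. h x * iexp (- t * X x) \<partial>M)"
      by (rule Bochner_Integration.integral_cnj)
    finally show ?thesis
      unfolding zero by simp
  qed
  have Rez: "(\<integral>x. of_real (Re (h x)) * iexp (t * X x) \<partial>M) = 0" for t
  proof -
    have "(\<integral>x. of_real (Re (h x)) * iexp (t * X x) \<partial>M)
        = (\<integral>x. (h x * iexp (t * X x) + cnj (h x) * iexp (t * X x)) / 2 \<partial>M)"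
      by (intro Bochner_Integration.integral_cong refl)
         (simp add: distrib_right[symmetric] complex_add_cnj)
    also have "\<dots> = 0"
      by (simp only: integral_divide_zero Bochner_Integration.integral_add[OF int[OF h] int[OF hc]] zero cnjz) simp
    finally show ?thesis .
  qed
  have Imz: "(\<integral>x. of_real (Im (h x)) * iexp (t * X x) \<partial>M) = 0" for t
  proof -
    have "(\<integral>x. of_real (Im (h x)) * iexp (t * X x) \<partial>M)
        = (\<integral>x. (h x * iexp (t * X x) - cnj (h x) * iexp (t * X x)) / (2 * \<i>) \<partial>M)"
    proof (intro Bochner_Integration.integral_cong refl)
      fix x
      have "h x * e - cnj (h x) * e = (2 * \<i>) * (of_real (Im (h x)) * e)" for e
        by (simp add: left_diff_distrib[symmetric] complex_diff_cnj)
      then show "of_real (Im (h x)) * iexp (t * X x)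
          = (h x * iexp (t * X x) - cnj (h x) * iexp (t * X x)) / (2 * \<i>)"
        by simp
    qed
    also have "\<dots> = 0"
      by (simp only: integral_divide_zero Bochner_Integration.integral_diff[OF int[OF h] int[OF hc]] zero cnjz) simp
    finally show ?thesis .
  qed
  have ReIm: "Re (indicator A y) = indicator A y" "Im (indicator A y) = 0" for y :: real
    by (simp_all split: split_indicator)
  have "integrable M (\<lambda>x. h x * indicator A (X x))"
    by (rule Bochner_Integration.integrable_bound[OF h]) (auto simp: indicator_def)
  then show ?thesis
    using Fourier_zero_indicator_real[OF _ X Rez A] Fourier_zero_indicator_real[OF _ X Imz A] h
    by (subst integral_complex_eq_0_iff) (simp_all add: ReIm)
qed

text \<open>One coordinate at a time: while the last one is treated, the exponential of the others
  is part of the weight, and afterwards the new indicator is. This works because the weight is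
  complex and need not be a function of the \<open>X j\<close>.\<close>

lemma Fourier_zero_box:
  fixes h :: "'a \<Rightarrow> complex" and X :: "nat \<Rightarrow> 'a \<Rightarrow> real"
  assumes "integrable M h" and "\<And>j. j < n \<Longrightarrow> X j \<in> borel_measurable M"
    and "\<And>t. (\<integral>x. h x * iexp (\<Sum>j<n. t j * X j x) \<partial>M) = 0"
    and "\<And>j. j < n \<Longrightarrow> A j \<in> sets borel"
  shows "(\<integral>x. h x * (\<Prod>j<n. indicator (A j) (X j x)) \<partial>M) = 0"
  using assms
proof (induction n arbitrary: h)
  case 0
  then show ?case by simp
next
  case (Suc n)
  note h = Suc.prems(1)
  have X [measurable]: "X j \<in> borel_measurable M" if "j \<le> n" for j
    using Suc.prems(2) that by auto
  have A [measurable]: "A n \<in> sets borel"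
    using Suc.prems(4) by auto
  have [measurable]: "h \<in> borel_measurable M" "X n \<in> borel_measurable M"
    using h by auto
  have "(\<integral>x. (h x * indicator (A n) (X n x)) * (\<Prod>j<n. indicator (A j) (X j x)) \<partial>M) = 0"
  proof (rule Suc.IH)
    show "integrable M (\<lambda>x. h x * indicator (A n) (X n x))"
      by (rule Bochner_Integration.integrable_bound[OF h]) (auto simp: indicator_def)
    fix t :: "nat \<Rightarrow> real"
    have [measurable]: "(\<lambda>x. \<Sum>j<n. t j * X j x) \<in> borel_measurable M"
      by (intro borel_measurable_sum borel_measurable_times) auto
    have "(\<integral>x. h x * iexp (\<Sum>j<n. t j * X j x) * indicator (A n) (X n x) \<partial>M) = 0"
    proof (rule Fourier_zero_indicator)
      show "integrable M (\<lambda>x. h x * iexp (\<Sum>j<n. t j * X j x))"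
        by (rule Bochner_Integration.integrable_bound[OF h]) (auto simp: norm_mult simp del: of_real_sum)
      fix s
      have "h x * iexp (\<Sum>j<n. t j * X j x) * iexp (s * X n x) = h x * iexp (\<Sum>j<Suc n. (t(n := s)) j * X j x)" for x
        by (simp add: exp_add distrib_left)
      then show "(\<integral>x. h x * iexp (\<Sum>j<n. t j * X j x) * iexp (s * X n x) \<partial>M) = 0"
        using Suc.prems(3)[of "t(n := s)"] by (simp only:)
    qed auto
    then show "(\<integral>x. h x * indicator (A n) (X n x) * iexp (\<Sum>j<n. t j * X j x) \<partial>M) = 0"
      by (simp add: mult_ac)
  qed (use Suc.prems in auto)
  then show ?case
    by (simp add: mult_ac)
qed

section \<open>From boxes to bounded measurable functions of all coordinates\<close>

lemma measure_eqI_PiM_borel: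
  fixes M N :: "('i \<Rightarrow> real) measure"
  assumes I: "finite I" and sets: "sets M = sets (\<Pi>\<^sub>M i\<in>I. borel)" "sets N = sets (\<Pi>\<^sub>M i\<in>I. borel)"
    and fin: "finite_measure M"
    and eq: "\<And>A. (\<And>i. i \<in> I \<Longrightarrow> A i \<in> sets borel) \<Longrightarrow> emeasure M (Pi\<^sub>E I A) = emeasure N (Pi\<^sub>E I A)"
  shows "M = N"
proof (rule measure_eqI_PiM_finite[OF I sets, of "\<lambda>_. \<Pi>\<^sub>E i\<in>I. UNIV"])
  show "range (\<lambda>_. \<Pi>\<^sub>E i\<in>I. UNIV) \<subseteq> prod_algebra I (\<lambda>_. borel)"
    using I by (auto intro!: prod_algebraI_finite)
  show "emeasure M (\<Pi>\<^sub>E i\<in>I. UNIV) \<noteq> \<infinity>"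
    using finite_measure.emeasure_finite[OF fin] by auto
qed (use eq in \<open>auto simp: space_PiM\<close>)

lemma Fourier_zero_real:
  fixes h :: "'a \<Rightarrow> real" and X :: "nat \<Rightarrow> 'a \<Rightarrow> real" and G :: "(nat \<Rightarrow> real) \<Rightarrow> complex"
  assumes h: "integrable M h" and X: "\<And>j. j < n \<Longrightarrow> X j \<in> borel_measurable M"
    and box: "\<And>A. (\<And>j. j < n \<Longrightarrow> A j \<in> sets borel) \<Longrightarrow> (\<integral>x. h x * (\<Prod>j<n. indicator (A j) (X j x)) \<partial>M) = 0"
    and G [measurable]: "G \<in> borel_measurable (Rd n)" and K: "\<And>y. norm (G y) \<le> K"
  shows "(\<integral>x. of_real (h x) * G (\<lambda>j\<in>{..<n}. X j x) \<partial>M) = 0"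
proof -
  have [measurable]: "h \<in> borel_measurable M"
    using h by auto
  have XR [measurable]: "(\<lambda>x. \<lambda>j\<in>{..<n}. X j x) \<in> M \<rightarrow>\<^sub>M Rd n"
    unfolding Rd_def by (rule measurable_restrict) (use X in auto)
  let ?X = "\<lambda>x. \<lambda>j\<in>{..<n}. X j x"
  define p q where "p x = max 0 (h x)" and "q x = max 0 (- h x)" for x
  have pint: "integrable M p" and nint: "integrable M q" and nn: "0 \<le> p x" "0 \<le> q x" for x
    using h by (auto simp: p_def [abs_def] q_def [abs_def])
  have hpn: "h x = p x - q x" for x
    by (auto simp: p_def q_def)
  let ?\<alpha> = "\<lambda>g. distr (density M (\<lambda>x. ennreal (g x))) (Rd n) ?X"
  have fin: "finite_measure (?\<alpha> p)" "finite_measure (?\<alpha> q)"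
    using pint nint nn by (auto intro!: finite_measure_distr_density)
  have "?\<alpha> p = ?\<alpha> q"
  proof (rule measure_eqI_PiM_borel)
    show "sets (?\<alpha> p) = sets (Pi\<^sub>M {..<n} (\<lambda>i. borel))" "sets (?\<alpha> q) = sets (Pi\<^sub>M {..<n} (\<lambda>i. borel))"
      by (auto simp: Rd_def)
    fix A :: "nat \<Rightarrow> real set" assume A: "\<And>i. i \<in> {..<n} \<Longrightarrow> A i \<in> sets borel"
    then have [measurable]: "Pi\<^sub>E {..<n} A \<in> sets (Rd n)"
      unfolding Rd_def by (intro sets_PiM_I_finite) auto
    have ind: "indicator (Pi\<^sub>E {..<n} A) (?X x) = (\<Prod>j<n. indicator (A j) (X j x) :: real)" for x
      by (auto simp: indicator_def PiE_def Pi_def)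
    have m: "measure (?\<alpha> g) (Pi\<^sub>E {..<n} A) = (\<integral>x. g x * (\<Prod>j<n. indicator (A j) (X j x)) \<partial>M)"
      if g: "integrable M g" "\<And>x. 0 \<le> g x" for g
    proof -
      have "measure (?\<alpha> g) (Pi\<^sub>E {..<n} A) = (\<integral>y. indicator (Pi\<^sub>E {..<n} A) y \<partial>?\<alpha> g)"
        using sets.sets_into_space[of "Pi\<^sub>E {..<n} A" "Rd n"] by (simp add: Int_absorb2)
      also have "\<dots> = (\<integral>x. g x *\<^sub>R indicator (Pi\<^sub>E {..<n} A) (?X x) \<partial>M)"
        by (rule integral_distr_density[OF g]) auto
      finally show ?thesis
        by (simp add: ind)
    qed
    have [measurable]: "(\<lambda>x. (\<Prod>j<n. indicator (A j) (X j x) :: real)) \<in> borel_measurable M"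
      using A X by (intro borel_measurable_prod) (auto intro!: measurable_compose[of "X _" M borel])
    have bnd: "\<bar>(\<Prod>j<n. indicator (A j) (X j x) :: real)\<bar> \<le> 1" for x
      unfolding ind[symmetric] by (auto simp: indicator_def)
    have intb: "integrable M (\<lambda>x. g x * (\<Prod>j<n. indicator (A j) (X j x)))" if "integrable M g" for g :: "'a \<Rightarrow> real"
      using that mult_left_mono[OF bnd, of "\<bar>g x\<bar>" x for x]
      by (intro Bochner_Integration.integrable_bound[OF that]) (auto simp: abs_mult)
    have "measure (?\<alpha> p) (Pi\<^sub>E {..<n} A) - measure (?\<alpha> q) (Pi\<^sub>E {..<n} A) =
        (\<integral>x. p x * (\<Prod>j<n. indicator (A j) (X j x)) - q x * (\<Prod>j<n. indicator (A j) (X j x)) \<partial>M)"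
      using intb[OF pint] intb[OF nint] by (simp add: m[OF pint nn(1)] m[OF nint nn(2)])
    also have "\<dots> = (\<integral>x. h x * (\<Prod>j<n. indicator (A j) (X j x)) \<partial>M)"
      by (simp only: left_diff_distrib[symmetric] hpn[symmetric])
    also have "\<dots> = 0"
      using A by (intro box) auto
    finally show "emeasure (?\<alpha> p) (Pi\<^sub>E {..<n} A) = emeasure (?\<alpha> q) (Pi\<^sub>E {..<n} A)"
      using fin by (simp add: finite_measure.emeasure_eq_measure)
  qed (use fin in auto)
  then have "(\<integral>y. G y \<partial>?\<alpha> p) = (\<integral>y. G y \<partial>?\<alpha> q)"
    by simp
  then have e: "(\<integral>x. p x *\<^sub>R G (?X x) \<partial>M) = (\<integral>x. q x *\<^sub>R G (?X x) \<partial>M)"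
    using pint nint nn by (simp add: integral_distr_density)
  have intG: "integrable M (\<lambda>x. g x *\<^sub>R G (?X x))" if g: "integrable M g" for g :: "'a \<Rightarrow> real"
  proof (rule Bochner_Integration.integrable_bound[of _ "\<lambda>x. K * g x"])
    have "0 \<le> K"
      using K[of undefined] norm_ge_zero order_trans by blast
    then show "AE x in M. norm (g x *\<^sub>R G (?X x)) \<le> norm (K * g x)"
      using K by (intro AE_I2) (simp add: abs_mult mult.commute[of K] mult_left_mono)
  qed (use g in auto)
  have "(\<integral>x. of_real (h x) * G (?X x) \<partial>M) = (\<integral>x. p x *\<^sub>R G (?X x) - q x *\<^sub>R G (?X x) \<partial>M)"
    by (simp add: hpn left_diff_distrib scaleR_conv_of_real)
  also have "\<dots> = 0"
    using intG[OF pint] intG[OF nint] e by (subst Bochner_Integration.integral_diff) auto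
  finally show ?thesis .
qed

text \<open>In other words, \<open>h\<close> has conditional expectation zero given the
  \<open>X j\<close>. The uses differ in the choice of \<open>h\<close>: a sign on two sheets for
  uniqueness of laws, \<open>exp (\<i> * (z * X j))\<close> for nondegeneracy, a difference of
  densities for their uniqueness.\<close>

lemma Fourier_zero:
  fixes h :: "'a \<Rightarrow> complex" and X :: "nat \<Rightarrow> 'a \<Rightarrow> real" and G :: "(nat \<Rightarrow> real) \<Rightarrow> complex"
  assumes h: "integrable M h" and X: "\<And>j. j < n \<Longrightarrow> X j \<in> borel_measurable M"
    and zero: "\<And>t. (\<integral>x. h x * iexp (\<Sum>j<n. t j * X j x) \<partial>M) = 0"
    and G [measurable]: "G \<in> borel_measurable (Rd n)" and K: "\<And>y. norm (G y) \<le> K"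
  shows "(\<integral>x. h x * G (\<lambda>j\<in>{..<n}. X j x) \<partial>M) = 0"
proof -
  have [measurable]: "h \<in> borel_measurable M"
    using h by auto
  have XR [measurable]: "(\<lambda>x. \<lambda>j\<in>{..<n}. X j x) \<in> M \<rightarrow>\<^sub>M Rd n"
    unfolding Rd_def by (rule measurable_restrict) (use X in auto)
  let ?X = "\<lambda>x. \<lambda>j\<in>{..<n}. X j x"
  have K0: "0 \<le> K"
    using K[of undefined] norm_ge_zero order_trans by blast
  have intG: "integrable M (\<lambda>x. of_real (g x) * G (?X x))" if g: "integrable M g" for g :: "'a \<Rightarrow> real"
  proof (rule Bochner_Integration.integrable_bound[of _ "\<lambda>x. K * g x"])
    show "AE x in M. norm (of_real (g x) * G (?X x)) \<le> norm (K * g x)"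
      using K K0 by (intro AE_I2) (simp add: norm_mult abs_mult mult.commute[of K] mult_left_mono)
  qed (use g in auto)
  have box: "(\<integral>x. Re (h x) * (\<Prod>j<n. indicator (A j) (X j x)) \<partial>M) = 0"
            "(\<integral>x. Im (h x) * (\<Prod>j<n. indicator (A j) (X j x)) \<partial>M) = 0"
    if A: "\<And>j. j < n \<Longrightarrow> A j \<in> sets borel" for A
  proof -
    let ?I = "\<lambda>x. \<Prod>j<n. indicator (A j) (X j x)"
    have [measurable]: "(\<lambda>x. ?I x :: complex) \<in> borel_measurable M"
      using A X by (intro borel_measurable_prod) (auto intro!: measurable_compose[of "X _" M borel])
    have real: "?I x = complex_of_real (?I x)" for x
      unfolding of_real_prod by (intro prod.cong refl) (simp split: split_indicator)
    have "norm (?I x :: complex) \<le> 1" for x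
      by (auto simp: prod_norm[symmetric] indicator_def intro!: prod_le_1)
    then have "integrable M (\<lambda>x. h x * ?I x)"
      using mult_left_mono[of "norm (?I x :: complex)" 1 "norm (h x)" for x]
      by (intro Bochner_Integration.integrable_bound[OF h]) (auto simp: norm_mult)
    from integral_complex_eq_0_iff[THEN iffD1, OF this Fourier_zero_box[OF h X zero A]]
    show "(\<integral>x. Re (h x) * ?I x \<partial>M) = 0" "(\<integral>x. Im (h x) * ?I x \<partial>M) = 0"
      unfolding real by (simp_all del: of_real_prod)
  qed
  have "(\<integral>x. of_real (Re (h x)) * G (?X x) \<partial>M) = 0" "(\<integral>x. of_real (Im (h x)) * G (?X x) \<partial>M) = 0"
    using h X box by (auto intro!: Fourier_zero_real[OF _ _ _ G K])
  moreover have "(\<integral>x. h x * G (?X x) \<partial>M)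
      = (\<integral>x. of_real (Re (h x)) * G (?X x) + \<i> * (of_real (Im (h x)) * G (?X x)) \<partial>M)"
    by (intro Bochner_Integration.integral_cong refl) (simp add: complex_eq[symmetric] distrib_right[symmetric] mult.assoc[symmetric])
  moreover have "\<dots> = (\<integral>x. of_real (Re (h x)) * G (?X x) \<partial>M) + (\<integral>x. \<i> * (of_real (Im (h x)) * G (?X x)) \<partial>M)"
    using h intG by (intro Bochner_Integration.integral_add integrable_mult_right) auto
  ultimately show ?thesis
    by simp
qed

lemma integral_indicator_distr:
  assumes A: "A \<in> sets N" and [measurable]: "Z \<in> M \<rightarrow>\<^sub>M N"
  shows "(\<integral>x. indicator A (Z x) \<partial>M) = complex_of_real (measure (distr M N Z) A)"
proof -
  have [measurable]: "A \<in> sets N" by fact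
  have "complex_of_real (measure (distr M N Z) A) = of_real (\<integral>x. indicator A (Z x) \<partial>M)"
    using sets.sets_into_space[OF A] by (subst integral_distr[of Z M N, symmetric]) (auto simp: Int_absorb2)
  also have "\<dots> = (\<integral>x. of_real (indicator A (Z x)) \<partial>M)"
    by simp
  also have "\<dots> = (\<integral>x. indicator A (Z x) \<partial>M)"
    by (intro Bochner_Integration.integral_cong refl) (simp split: split_indicator)
  finally show ?thesis ..
qed

text \<open>Both laws are placed on one space: two sheets labelled by a boolean, each a copy of
  \<open>P \<Otimes>\<^sub>M P'\<close>, with weight \<open>1\<close> on one and \<open>- 1\<close>
  on the other. Equality of the Fourier integrals then says that this signed weight satisfies the
  hypothesis of \<open>Fourier_zero\<close>.\<close>

lemma distr_eqI_Fourier: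
  fixes X :: "nat \<Rightarrow> 'a \<Rightarrow> real" and Y :: "nat \<Rightarrow> 'b \<Rightarrow> real"
  assumes P: "prob_space P" and P': "prob_space P'"
    and X: "\<And>j. j < d \<Longrightarrow> X j \<in> borel_measurable P" and Y: "\<And>j. j < d \<Longrightarrow> Y j \<in> borel_measurable P'"
    and eq: "\<And>t. (\<integral>x. iexp (\<Sum>j<d. t j * X j x) \<partial>P) = (\<integral>y. iexp (\<Sum>j<d. t j * Y j y) \<partial>P')"
  shows "distr P (Rd d) (\<lambda>x. \<lambda>j\<in>{..<d}. X j x) = distr P' (Rd d) (\<lambda>y. \<lambda>j\<in>{..<d}. Y j y)"
proof -
  interpret P: prob_space P by fact
  interpret P': prob_space P' by fact
  interpret PP: pair_prob_space P P' ..
  let ?C = "count_space (UNIV :: bool set)"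
  let ?M = "?C \<Otimes>\<^sub>M (P \<Otimes>\<^sub>M P')"
  interpret C: finite_measure ?C
    by (rule finite_measure_count_space) simp
  interpret M: pair_sigma_finite ?C "P \<Otimes>\<^sub>M P'" ..
  interpret MF: finite_measure ?M
    by (intro finite_measure_pair_measure C.finite_measure_axioms PP.finite_measure_axioms)
  define W where "W j = (\<lambda>(b, p, q). if b then X j p else Y j q)" for j
  define h :: "bool \<times> 'a \<times> 'b \<Rightarrow> complex" where "h = (\<lambda>(b, p, q). if b then 1 else - 1)"
  have W [measurable]: "W j \<in> borel_measurable ?M" if j: "j < d" for j
  proof -
    have [measurable]: "X j \<in> borel_measurable P" "Y j \<in> borel_measurable P'"
      using X Y j by auto
    show ?thesis unfolding W_def by measurable
  qed
  have h [measurable]: "h \<in> borel_measurable ?M"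
    unfolding h_def by measurable
  have hint: "integrable ?M h"
    by (rule MF.integrable_const_bound[where B = 1]) (auto simp: h_def)
  \<comment> \<open>On each sheet only one factor of \<open>P \<Otimes>\<^sub>M P'\<close> enters;
    the other integrates to 1.\<close>
  have split: "(\<integral>z. h z * g (W' z) \<partial>?M) = (\<integral>x. g (X' x) \<partial>P) - (\<integral>y. g (Y' y) \<partial>P')"
    if g [measurable]: "g \<in> borel_measurable N" and gb: "\<And>v. norm (g v) \<le> 1"
      and X' [measurable]: "X' \<in> P \<rightarrow>\<^sub>M N" and Y' [measurable]: "Y' \<in> P' \<rightarrow>\<^sub>M N"
      and W': "W' = (\<lambda>(b, p, q). if b then X' p else Y' q)"
    for g :: "'c \<Rightarrow> complex" and N and X' Y' W'
  proof -
    have [measurable]: "W' \<in> ?M \<rightarrow>\<^sub>M N"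
      unfolding W' by measurable
    have hn: "norm (h z) \<le> 1" for z
      by (auto simp: h_def split: prod.split)
    have int: "integrable ?M (\<lambda>z. h z * g (W' z))"
      by (rule MF.integrable_const_bound[where B = 1]) (use gb hn in \<open>auto simp: norm_mult mult_le_one\<close>)
    have "(\<integral>z. h z * g (W' z) \<partial>?M) = (\<integral>b. (\<integral>pq. h (b, pq) * g (W' (b, pq)) \<partial>(P \<Otimes>\<^sub>M P')) \<partial>?C)"
      using M.integral_fst'[of "\<lambda>z. h z * g (W' z)"] int by simp
    also have "\<dots> = (\<Sum>b\<in>UNIV. \<integral>pq. h (b, pq) * g (W' (b, pq)) \<partial>(P \<Otimes>\<^sub>M P'))"
      by (simp add: lebesgue_integral_count_space_finite)
    also have "\<dots> = (\<integral>pq. g (X' (fst pq)) \<partial>(P \<Otimes>\<^sub>M P')) - (\<integral>pq. g (Y' (snd pq)) \<partial>(P \<Otimes>\<^sub>M P'))"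
      by (simp add: UNIV_bool h_def W' case_prod_beta)
    also have "(\<integral>pq. g (X' (fst pq)) \<partial>(P \<Otimes>\<^sub>M P')) = (\<integral>x. g (X' x) \<partial>P)"
    proof -
      have "integrable (P \<Otimes>\<^sub>M P') (\<lambda>pq. g (X' (fst pq)))"
        by (rule PP.integrable_const_bound[where B = 1]) (use gb in auto)
      from PP.integral_fst'[OF this] show ?thesis
        by (simp add: P'.prob_space)
    qed
    also have "(\<integral>pq. g (Y' (snd pq)) \<partial>(P \<Otimes>\<^sub>M P')) = (\<integral>y. g (Y' y) \<partial>P')"
    proof -
      have "integrable (P \<Otimes>\<^sub>M P') (\<lambda>pq. g (Y' (snd pq)))"
        by (rule PP.integrable_const_bound[where B = 1]) (use gb in auto)
      from PP.integral_fst'[OF this] show ?thesis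
        by (simp add: P.prob_space)
    qed
    finally show ?thesis .
  qed
  have XR [measurable]: "(\<lambda>x. \<lambda>j\<in>{..<d}. X j x) \<in> P \<rightarrow>\<^sub>M Rd d"
    unfolding Rd_def by (rule measurable_restrict) (use X in auto)
  have YR [measurable]: "(\<lambda>x. \<lambda>j\<in>{..<d}. Y j x) \<in> P' \<rightarrow>\<^sub>M Rd d"
    unfolding Rd_def by (rule measurable_restrict) (use Y in auto)
  have zero: "(\<integral>z. h z * iexp (\<Sum>j<d. t j * W j z) \<partial>?M) = 0" for t
  proof -
    have "(\<lambda>x. \<Sum>j<d. t j * X j x) \<in> borel_measurable P" "(\<lambda>x. \<Sum>j<d. t j * Y j x) \<in> borel_measurable P'"
      using X Y by (auto intro!: borel_measurable_sum borel_measurable_times)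
    moreover have "(\<lambda>z. \<Sum>j<d. t j * W j z) = (\<lambda>(b, p, q). if b then (\<Sum>j<d. t j * X j p) else (\<Sum>j<d. t j * Y j q))"
      by (auto simp: W_def fun_eq_iff)
    ultimately show ?thesis
      using split[of iexp borel "\<lambda>x. \<Sum>j<d. t j * X j x" "\<lambda>y. \<Sum>j<d. t j * Y j y" "\<lambda>z. \<Sum>j<d. t j * W j z"] eq[of t]
      by (simp del: of_real_sum)
  qed
  show ?thesis
  proof (rule measure_eqI)
    fix A assume "A \<in> sets (distr P (Rd d) (\<lambda>x. \<lambda>j\<in>{..<d}. X j x))"
    then have A [measurable]: "A \<in> sets (Rd d)" by simp
    have Wr: "(\<lambda>z. \<lambda>j\<in>{..<d}. W j z) = (\<lambda>(b, p, q). if b then (\<lambda>j\<in>{..<d}. X j p) else (\<lambda>j\<in>{..<d}. Y j q))"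
      by (auto simp: W_def fun_eq_iff restrict_def)
    have "(\<integral>z. h z * indicator A (\<lambda>j\<in>{..<d}. W j z) \<partial>?M) = 0"
      by (rule Fourier_zero[OF hint W zero, where K = 1]) (auto simp: indicator_def)
    then have "(\<integral>x. indicator A (\<lambda>j\<in>{..<d}. X j x) \<partial>P) = (\<integral>y. (indicator A (\<lambda>j\<in>{..<d}. Y j y) :: complex) \<partial>P')"
      using split[OF _ _ XR YR Wr, of "indicator A"] by (simp add: indicator_def)
    then have "measure (distr P (Rd d) (\<lambda>x. \<lambda>j\<in>{..<d}. X j x)) A = measure (distr P' (Rd d) (\<lambda>y. \<lambda>j\<in>{..<d}. Y j y)) A"
      using integral_indicator_distr[OF A XR] integral_indicator_distr[OF A YR] by simp
    moreover have "finite_measure (distr P (Rd d) (\<lambda>x. \<lambda>j\<in>{..<d}. X j x))" "finite_measure (distr P' (Rd d) (\<lambda>y. \<lambda>j\<in>{..<d}. Y j y))"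
      by (auto intro: P.finite_measure_distr P'.finite_measure_distr)
    ultimately show "emeasure (distr P (Rd d) (\<lambda>x. \<lambda>j\<in>{..<d}. X j x)) A = emeasure (distr P' (Rd d) (\<lambda>y. \<lambda>j\<in>{..<d}. Y j y)) A"
      by (simp add: finite_measure.emeasure_eq_measure)
  qed simp
qed

section \<open>Characteristic functions of bounded signals\<close>

text \<open>Bounds on \<open>h\<close> and \<open>Y\<close> dominate the exponential series by a
  summable one, so it may be integrated term by term; the result is an everywhere convergent power
  series in \<open>z\<close>.\<close>

lemma holomorphic_integral_exp:
  fixes h Y :: "'a \<Rightarrow> complex"
  assumes fin: "finite_measure M" and [measurable]: "h \<in> borel_measurable M" "Y \<in> borel_measurable M"
    and h: "\<And>x. norm (h x) \<le> K" and Y: "\<And>x. norm (Y x) \<le> L"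
  shows "(\<lambda>z. \<integral>x. h x * exp (z * Y x) \<partial>M) holomorphic_on UNIV"
proof -
  interpret finite_measure M by fact
  have K0: "0 \<le> K" and L0: "0 \<le> L"
    using h[of undefined] Y[of undefined] norm_ge_zero order_trans by blast+
  define a where "a n = (\<integral>x. h x * Y x ^ n / fact n \<partial>M)" for n
  have sums: "(\<lambda>n. a n * z ^ n) sums (\<integral>x. h x * exp (z * Y x) \<partial>M)" for z
  proof -
    let ?f = "\<lambda>n x. h x * ((z * Y x) ^ n /\<^sub>R fact n)"
    have nf: "norm (?f n x) \<le> K * ((norm z * L) ^ n /\<^sub>R fact n)" for n x
    proof -
      have "norm (?f n x) = norm (h x) * ((norm z * norm (Y x)) ^ n /\<^sub>R fact n)"
        by (simp add: norm_mult norm_power)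
      also have "\<dots> \<le> K * ((norm z * L) ^ n /\<^sub>R fact n)"
        using h[of x] Y[of x] K0
        by (intro mult_mono scaleR_left_mono power_mono mult_left_mono) auto
      finally show ?thesis .
    qed
    have int: "integrable M (?f n)" for n
      by (rule integrable_const_bound[where B = "K * ((norm z * L) ^ n /\<^sub>R fact n)"]) (use nf in auto)
    have "(\<lambda>n. integral\<^sup>L M (?f n)) sums (\<integral>x. (\<Sum>n. ?f n x) \<partial>M)"
    proof (rule sums_integral[OF int])
      have sumK: "summable (\<lambda>n. K * ((norm z * L) ^ n /\<^sub>R fact n))"
        by (intro summable_mult summable_exp_generic)
      show "AE x in M. summable (\<lambda>n. norm (?f n x))"
        by (intro AE_I2 summable_comparison_test[OF _ sumK]) (use nf in auto)
      have "summable (\<lambda>n. K * ((norm z * L) ^ n /\<^sub>R fact n) * measure M (space M))"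
        by (intro summable_mult2 sumK)
      then show "summable (\<lambda>n. \<integral>x. norm (?f n x) \<partial>M)"
      proof (rule summable_comparison_test[rotated], intro exI allI impI)
        fix n
        have "(\<integral>x. norm (?f n x) \<partial>M) \<le> (\<integral>x. K * ((norm z * L) ^ n /\<^sub>R fact n) \<partial>M)"
          by (intro integral_mono integrable_norm int integrable_const nf)
        then show "norm (\<integral>x. norm (?f n x) \<partial>M) \<le> K * ((norm z * L) ^ n /\<^sub>R fact n) * measure M (space M)"
          by (simp add: mult_ac)
      qed
    qed
    moreover have "(\<Sum>n. ?f n x) = h x * exp (z * Y x)" for x
      unfolding exp_def by (rule suminf_mult) (rule summable_exp_generic)
    moreover have "integral\<^sup>L M (?f n) = a n * z ^ n" for n
    proof -
      have "integral\<^sup>L M (?f n) = (\<integral>x. h x * Y x ^ n / fact n * z ^ n \<partial>M)"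
        by (intro Bochner_Integration.integral_cong refl)
           (simp add: scaleR_conv_of_real power_mult_distrib divide_inverse)
      then show ?thesis
        by (simp add: a_def)
    qed
    ultimately show ?thesis by simp
  qed
  have "(\<lambda>z. \<integral>x. h x * exp (z * Y x) \<partial>M) field_differentiable (at z)" for z
  proof -
    have "(\<lambda>z. \<integral>x. h x * exp (z * Y x) \<partial>M) holomorphic_on ball 0 (norm z + 1)"
      by (rule power_series_holomorphic[where a = a]) (use sums in simp)
    then show ?thesis
      by (rule holomorphic_on_imp_differentiable_at) auto
  qed
  then show ?thesis
    by (auto simp: holomorphic_on_def field_differentiable_at_within)
qed

definition cf :: "'a measure \<Rightarrow> (nat \<Rightarrow> 'a \<Rightarrow> real) \<Rightarrow> nat \<Rightarrow> (nat \<Rightarrow> complex) \<Rightarrow> complex" where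
  "cf P X d t = (\<integral>\<omega>. exp (\<i> * (\<Sum>j<d. t j * of_real (X j \<omega>))) \<partial>P)"

definition marginal_cf :: "'a measure \<Rightarrow> (nat \<Rightarrow> 'a \<Rightarrow> real) \<Rightarrow> nat \<Rightarrow> nat \<Rightarrow> complex \<Rightarrow> complex" where
  "marginal_cf P X d j z = cf P X d ((\<lambda>_. 0)(j := z))"

locale bounded_signal = prob_space P for P :: "'a measure" +
  fixes X :: "nat \<Rightarrow> 'a \<Rightarrow> real" and d :: nat and B :: real
  assumes X_measurable [measurable]: "j < d \<Longrightarrow> X j \<in> borel_measurable P"
    and X_bounded: "j < d \<Longrightarrow> \<bar>X j \<omega>\<bar> \<le> B"
    and B_nonneg: "0 \<le> B"
begin

lemma norm_sum_le: "norm (\<Sum>j<d. t j * complex_of_real (X j \<omega>)) \<le> (\<Sum>j<d. norm (t j) * B)"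
  by (rule sum_norm_le) (simp add: norm_mult mult_left_mono X_bounded)

lemma sum_measurable [measurable]: "(\<lambda>\<omega>. \<Sum>j<d. t j * complex_of_real (X j \<omega>)) \<in> borel_measurable P"
  by (intro borel_measurable_sum) auto

lemma cf_integrable: "integrable P (\<lambda>\<omega>. exp (\<i> * (\<Sum>j<d. t j * of_real (X j \<omega>))))"
proof (rule integrable_const_bound[where B = "exp (\<Sum>j<d. norm (t j) * B)"])
  have "norm (exp (\<i> * (\<Sum>j<d. t j * complex_of_real (X j \<omega>)))) \<le> exp (\<Sum>j<d. norm (t j) * B)" for \<omega>
    by (rule order_trans[OF norm_exp]) (simp add: norm_mult norm_sum_le)
  then show "AE \<omega> in P. norm (exp (\<i> * (\<Sum>j<d. t j * complex_of_real (X j \<omega>)))) \<le> exp (\<Sum>j<d. norm (t j) * B)"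
    by simp
qed simp

text \<open>The part of the exponent that is constant along the line goes into the bounded weight.
  All analyticity of \<open>cf\<close> is used in this form.\<close>

lemma cf_line_holomorphic: "(\<lambda>z. cf P X d (\<lambda>j. a j + z * b j)) holomorphic_on UNIV"
proof -
  have "cf P X d (\<lambda>j. a j + z * b j) =
     (\<integral>\<omega>. exp (\<i> * (\<Sum>j<d. a j * of_real (X j \<omega>))) * exp (z * (\<i> * (\<Sum>j<d. b j * of_real (X j \<omega>)))) \<partial>P)" for z
    unfolding cf_def
    by (intro Bochner_Integration.integral_cong refl)
       (simp add: exp_add[symmetric] distrib_right sum.distrib sum_distrib_left distrib_left mult_ac)
  moreover have "(\<lambda>z. \<integral>\<omega>. exp (\<i> * (\<Sum>j<d. a j * of_real (X j \<omega>))) * exp (z * (\<i> * (\<Sum>j<d. b j * of_real (X j \<omega>)))) \<partial>P)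
      holomorphic_on UNIV"
  proof (rule holomorphic_integral_exp)
    show "norm (exp (\<i> * (\<Sum>j<d. a j * complex_of_real (X j \<omega>)))) \<le> exp (\<Sum>j<d. norm (a j) * B)" for \<omega>
      by (rule order_trans[OF norm_exp]) (simp add: norm_mult norm_sum_le)
    show "norm (\<i> * (\<Sum>j<d. b j * complex_of_real (X j \<omega>))) \<le> (\<Sum>j<d. norm (b j) * B)" for \<omega>
      by (simp add: norm_mult norm_sum_le)
  qed (auto intro: finite_measure_axioms)
  ultimately show ?thesis by simp
qed

lemma cf_0 [simp]: "cf P X d (\<lambda>_. 0) = 1"
  by (simp add: cf_def prob_space)

lemma marginal_cf_0 [simp]: "marginal_cf P X d j 0 = 1"
  using cf_0 by (simp add: marginal_cf_def fun_upd_def cong: if_cong)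

lemma marginal_cf_eq: "j < d \<Longrightarrow> marginal_cf P X d j z = (\<integral>\<omega>. exp (\<i> * (z * of_real (X j \<omega>))) \<partial>P)"
  by (simp add: marginal_cf_def cf_def if_distrib[of "\<lambda>x. x * _"] cong: if_cong)

lemma marginal_cf_line_holomorphic: "(\<lambda>z. marginal_cf P X d j (a + z * b)) holomorphic_on UNIV"
proof -
  have "(\<lambda>_. 0)(j := a + z * b) = (\<lambda>l. ((\<lambda>_. 0)(j := a)) l + z * ((\<lambda>_. 0)(j := b)) l)" for z
    by auto
  then show ?thesis
    unfolding marginal_cf_def by (simp only: cf_line_holomorphic)
qed

lemma marginal_cf_holomorphic: "marginal_cf P X d j holomorphic_on UNIV"
  using marginal_cf_line_holomorphic[of j 0 1] by simp

lemma norm_marginal_cf_le: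
  assumes j: "j < d"
  shows "norm (marginal_cf P X d j z) \<le> exp (B * norm z)"
proof -
  have b: "norm (exp (\<i> * (z * complex_of_real (X j \<omega>)))) \<le> exp (B * norm z)" for \<omega>
    by (rule order_trans[OF norm_exp])
       (use X_bounded[OF j] in \<open>simp add: norm_mult mult.commute[of B] mult_left_mono\<close>)
  have [measurable]: "X j \<in> borel_measurable P"
    using j by simp
  have "norm (marginal_cf P X d j z) \<le> (\<integral>\<omega>. norm (exp (\<i> * (z * complex_of_real (X j \<omega>)))) \<partial>P)"
    unfolding marginal_cf_eq[OF j] by (rule integral_norm_bound)
  also have "\<dots> \<le> (\<integral>\<omega>. exp (B * norm z) \<partial>P)"
    by (intro integral_mono integrable_const_bound[where B = "exp (B * norm z)"])
       (use b in auto)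
  finally show ?thesis
    by (simp add: prob_space)
qed

text \<open>As \<open>X j\<close> is real, the values at \<open>- s\<close> and \<open>s\<close> are
  conjugate. This symmetry later forces the shift to be real.\<close>

lemma norm_marginal_cf_minus_real:
  assumes j: "j < d"
  shows "norm (marginal_cf P X d j (- of_real s)) = norm (marginal_cf P X d j (of_real s))"
proof -
  have "marginal_cf P X d j (- of_real s) = (\<integral>\<omega>. cnj (exp (\<i> * (of_real s * of_real (X j \<omega>)))) \<partial>P)"
    unfolding marginal_cf_eq[OF j] by (intro Bochner_Integration.integral_cong refl) (simp add: exp_cnj)
  then show ?thesis
    by (simp add: marginal_cf_eq[OF j])
qed

end

lemma local_quotient_marginal_cf:
  assumes S: "bounded_signal P X d B" and T: "bounded_signal P' X' d B'"
    and id: "\<And>t. cf P X d t * (\<Prod>j<d. marginal_cf P' X' d j (t j)) = cf P' X' d t * (\<Prod>j<d. marginal_cf P X d j (t j))"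
    and j: "j < d" and nondeg: "\<exists>t. t j = z0 \<and> cf P X d t \<noteq> 0"
  shows "\<exists>H1 H2. H1 holomorphic_on UNIV \<and> H2 holomorphic_on UNIV \<and> H1 z0 \<noteq> 0 \<and>
           (\<forall>z. H1 z * marginal_cf P' X' d j z = H2 z * marginal_cf P X d j z)"
proof -
  interpret S: bounded_signal P X d B by fact
  interpret T: bounded_signal P' X' d B' by fact
  obtain t where t: "t j = z0" "cf P X d t \<noteq> 0"
    using nondeg by blast
  \<comment> \<open>A line in the other coordinates: the marginal factors are 1 at
    \<open>s = 0\<close>, and \<open>cf\<close> is nonzero at \<open>s = 1\<close> by the choice of
    \<open>t\<close>. Two entire functions of \<open>s\<close>, neither identically zero, are both
    nonzero at some common \<open>s\<close>.\<close>
  let ?ts = "\<lambda>s l. (if l = j then z0 else 0) + s * (if l = j then 0 else t l)"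
  have ts1: "?ts 1 = t"
    using t(1) by auto
  have "\<exists>s. cf P X d (?ts s) * (\<Prod>l\<in>{..<d} - {j}. marginal_cf P' X' d l (0 + s * t l)) \<noteq> 0"
  proof (rule ccontr)
    assume "\<not> ?thesis"
    then have "cf P X d (?ts 1) = 0"
      by (intro entire_mult_eq_0[where a = 0 and D = "\<lambda>s. cf P X d (?ts s)" and z = 1
            and E = "\<lambda>s. \<Prod>l\<in>{..<d} - {j}. marginal_cf P' X' d l (0 + s * t l)"]
          S.cf_line_holomorphic holomorphic_on_prod T.marginal_cf_line_holomorphic) auto
    with t(2) ts1 show False by simp
  qed
  then obtain s where s: "cf P X d (?ts s) \<noteq> 0" "(\<Prod>l\<in>{..<d} - {j}. marginal_cf P' X' d l (s * t l)) \<noteq> 0"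
    by auto
  define u where "u z l = (if l = j then 0 else s * t l) + z * (if l = j then 1 else 0)" for z l
  have uj: "u z j = z" and ul: "l \<noteq> j \<Longrightarrow> u z l = s * t l" for z l
    by (auto simp: u_def)
  have uz0: "u z0 = ?ts s"
    by (auto simp: u_def)
  have split: "(\<Prod>l<d. g l (u z l)) = g j z * (\<Prod>l\<in>{..<d} - {j}. g l (s * t l))" for g :: "nat \<Rightarrow> complex \<Rightarrow> complex" and z
    using j by (subst prod.remove[of _ j]) (auto simp: uj ul intro!: prod.cong)
  let ?H1 = "\<lambda>z. cf P X d (u z) * (\<Prod>l\<in>{..<d} - {j}. marginal_cf P' X' d l (s * t l))"
  let ?H2 = "\<lambda>z. cf P' X' d (u z) * (\<Prod>l\<in>{..<d} - {j}. marginal_cf P X d l (s * t l))"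
  have "?H1 holomorphic_on UNIV" "?H2 holomorphic_on UNIV"
    unfolding u_def by (intro holomorphic_intros S.cf_line_holomorphic T.cf_line_holomorphic)+
  moreover have "?H1 z0 \<noteq> 0"
    using s by (simp only: uz0) simp
  moreover have "?H1 z * marginal_cf P' X' d j z = ?H2 z * marginal_cf P X d j z" for z
    using id[of "u z"] unfolding split by (simp add: mult_ac)
  ultimately show ?thesis by blast
qed

text \<open>The unknown factors \<open>\<psi>\<close>, \<open>\<psi>'\<close> (characteristic functions of the noise) are eliminated
  near the origin by comparing with the marginals; all that is left is an identity between entire
  functions, in which nondegeneracy forces the marginals to have the same zeros.\<close>

lemma cf_eq_up_to_shift:
  fixes \<psi> \<psi>' :: "nat \<Rightarrow> real \<Rightarrow> complex"
  assumes S: "bounded_signal P X d B" and T: "bounded_signal P' X' d B'"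
    and psi: "\<And>j. j < d \<Longrightarrow> \<psi> j 0 = 1"
    and psi': "\<And>j. j < d \<Longrightarrow> \<psi>' j 0 = 1" "\<And>j. j < d \<Longrightarrow> isCont (\<psi>' j) 0"
    and eq: "\<And>t. cf P X d (\<lambda>j. of_real (t j)) * (\<Prod>j<d. \<psi> j (t j))
                = cf P' X' d (\<lambda>j. of_real (t j)) * (\<Prod>j<d. \<psi>' j (t j))"
    and nondeg: "\<And>j z. j < d \<Longrightarrow> \<exists>t. t j = z \<and> cf P X d t \<noteq> 0"
    and nondeg': "\<And>j z. j < d \<Longrightarrow> \<exists>t. t j = z \<and> cf P' X' d t \<noteq> 0"
  shows "\<exists>m :: nat \<Rightarrow> real. \<forall>t. cf P' X' d t = exp (\<i> * (\<Sum>j<d. t j * of_real (m j))) * cf P X d t"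
proof -
  interpret S: bounded_signal P X d B by fact
  interpret T: bounded_signal P' X' d B' by fact
  let ?\<phi> = "marginal_cf P X d" and ?\<phi>' = "marginal_cf P' X' d"
  \<comment> \<open>All coordinates but \<open>j\<close> are set to 0, where the other noise factors
    equal 1.\<close>
  have marg: "?\<phi> j (of_real s) * \<psi> j s = ?\<phi>' j (of_real s) * \<psi>' j s" if j: "j < d" for j s
  proof -
    have e: "(\<lambda>l. complex_of_real (((\<lambda>_. 0)(j := s)) l)) = (\<lambda>_. 0)(j := of_real s)"
      by auto
    have "(\<Prod>l<d. g l (((\<lambda>_. 0)(j := s)) l)) = g j s" if "\<And>l. l < d \<Longrightarrow> g l 0 = 1" for g :: "nat \<Rightarrow> real \<Rightarrow> complex"
      using j that by (subst prod.remove[of _ j]) auto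
    then show ?thesis
      using eq[of "(\<lambda>_. 0)(j := s)"] psi psi'(1) unfolding e marginal_cf_def by simp
  qed
  define F where "F t = cf P X d t * (\<Prod>j<d. ?\<phi>' j (t j)) - cf P' X' d t * (\<Prod>j<d. ?\<phi> j (t j))" for t
  have F_line: "(\<lambda>z. F (\<lambda>j. a j + z * b j)) holomorphic_on UNIV" for a b
    unfolding F_def
    by (intro holomorphic_intros S.cf_line_holomorphic T.cf_line_holomorphic
          holomorphic_on_prod S.marginal_cf_line_holomorphic T.marginal_cf_line_holomorphic)
  have F_real: "F (\<lambda>j. of_real (t j)) = 0" for t :: "nat \<Rightarrow> real"
  proof -
    have "\<forall>\<^sub>F s in at 0. \<psi>' j (s * t j) \<noteq> 0" if j: "j < d" for j
    proof -
      have "isCont (\<lambda>s. \<psi>' j (s * t j)) 0"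
        by (rule isCont_o2[of _ "\<lambda>s. s * t j"]) (use psi'(2)[OF j] in auto)
      then have "((\<lambda>s. \<psi>' j (s * t j)) \<longlongrightarrow> \<psi>' j (0 * t j)) (at 0)"
        by (simp add: isCont_def)
      then show ?thesis
        by (rule tendsto_imp_eventually_ne) (simp add: psi'(1)[OF j])
    qed
    then have "\<forall>\<^sub>F s in at 0. \<forall>j\<in>{..<d}. \<psi>' j (s * t j) \<noteq> 0"
      by (intro eventually_ball_finite) auto
    then obtain e where e: "e > 0" "\<And>s j. \<bar>s\<bar> < e \<Longrightarrow> s \<noteq> 0 \<Longrightarrow> j < d \<Longrightarrow> \<psi>' j (s * t j) \<noteq> 0"
      by (auto simp: eventually_at dist_real_def)
    have nz: "(\<Prod>j<d. \<psi>' j (s * t j)) \<noteq> 0" if "\<bar>s\<bar> < e" for s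
      using e(2)[OF that] psi'(1) by (cases "s = 0") auto
    \<comment> \<open>After multiplication by the product of the \<open>\<psi>' j\<close>, the
      marginal relation trades \<open>\<phi>' \<psi>'\<close> for \<open>\<phi> \<psi>\<close>, and
      the main equation restores \<open>\<psi>'\<close>. Cancelling that product is possible because
      \<open>s\<close> is small.\<close>
    have "F (\<lambda>j. 0 + of_real s * of_real (t j)) = 0" if s: "\<bar>s\<bar> < e" for s
    proof -
      let ?t = "\<lambda>j. complex_of_real (s * t j)"
      have "cf P X d ?t * (\<Prod>j<d. ?\<phi>' j (?t j)) * (\<Prod>j<d. \<psi>' j (s * t j))
          = cf P X d ?t * (\<Prod>j<d. ?\<phi>' j (?t j) * \<psi>' j (s * t j))"
        by (simp add: prod.distrib mult_ac)
      also have "\<dots> = cf P X d ?t * (\<Prod>j<d. ?\<phi> j (?t j) * \<psi> j (s * t j))"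
        by (rule arg_cong, rule prod.cong[OF refl], rule marg[symmetric]) simp
      also have "\<dots> = cf P X d ?t * (\<Prod>j<d. \<psi> j (s * t j)) * (\<Prod>j<d. ?\<phi> j (?t j))"
        by (simp add: prod.distrib mult_ac)
      also have "\<dots> = cf P' X' d ?t * (\<Prod>j<d. \<psi>' j (s * t j)) * (\<Prod>j<d. ?\<phi> j (?t j))"
        unfolding eq ..
      finally have "F ?t * (\<Prod>j<d. \<psi>' j (s * t j)) = 0"
        by (simp add: F_def algebra_simps)
      with nz[OF s] show ?thesis
        by simp
    qed
    from entire_eq_0_of_real_interval[OF F_line e(1) this, of 1]
    show ?thesis by simp
  qed
  have F0: "F t = 0" for t
  proof -
    \<comment> \<open>The complex point \<open>t\<close> lies on the line through its real part in
      the direction of its imaginary part, at parameter \<open>\<i>\<close>; real parameters give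
      real points.\<close>
    have "F (\<lambda>j. of_real (Re (t j)) + of_real s * of_real (Im (t j))) = 0" for s
      using F_real[of "\<lambda>j. Re (t j) + s * Im (t j)"] by simp
    from entire_eq_0_of_real_interval[OF F_line zero_less_one this, of \<i>]
    show ?thesis
      by (simp add: complex_eq[symmetric])
  qed
  then have id: "cf P X d t * (\<Prod>j<d. ?\<phi>' j (t j)) = cf P' X' d t * (\<Prod>j<d. ?\<phi> j (t j))" for t
    by (simp add: F_def)
  have "\<exists>m :: real. \<forall>z. ?\<phi>' j z = ?\<phi> j z * exp (\<i> * (z * of_real m))" if j: "j < d" for j
  proof -
    note hol = S.marginal_cf_holomorphic[of j] T.marginal_cf_holomorphic[of j]
    obtain w where w: "w holomorphic_on UNIV" "\<And>z. ?\<phi>' j z = ?\<phi> j z * w z"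
      by (rule entire_quotient[OF hol(2,1), of 0])
         (use local_quotient_marginal_cf[OF S T id j nondeg[OF j]] in auto)
    obtain w' where w': "w' holomorphic_on UNIV" "\<And>z. ?\<phi> j z = ?\<phi>' j z * w' z"
      by (rule entire_quotient[OF hol, of 0])
         (use local_quotient_marginal_cf[OF T S id[symmetric] j nondeg'[OF j]] in auto)
    \<comment> \<open>The two quotients are mutually inverse where \<open>?\<phi> j\<close> is
      nonzero, hence everywhere; so \<open>w\<close> has no zeros and admits an entire
      logarithm.\<close>
    have "w z * w' z - 1 = 0" for z
    proof (rule entire_mult_eq_0[of "\<lambda>z. w z * w' z - 1" "?\<phi> j" 0])
      show "(w z * w' z - 1) * ?\<phi> j z = 0" for z
        using w(2)[of z] w'(2)[of z] by (simp add: algebra_simps)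
    qed (auto intro!: holomorphic_intros w w' hol)
    then have wnz: "w z \<noteq> 0" for z
      by (metis eq_iff_diff_eq_0 mult_zero_left zero_neq_one)
    obtain h where h: "h holomorphic_on UNIV" "\<And>z. exp (h z) = w z"
      by (rule holomorphic_logarithm_exists[of UNIV w 0]) (use w wnz in auto)
    have "h z = h 0 + deriv h 0 * z" for z
    proof (rule exponential_type_quotient_linear[OF hol(2,1) h(1), of "max B B'"])
      have le: "exp (b * norm z) \<le> exp (max B B' * norm z)" if "b \<in> {B, B'}" for b and z :: complex
        using that by (auto intro!: mult_right_mono)
      show "norm (?\<phi> j z) \<le> exp (max B B' * norm z)" for z
        using order_trans[OF S.norm_marginal_cf_le[OF j] le] by simp
      show "norm (?\<phi>' j z) \<le> exp (max B B' * norm z)" for z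
        using order_trans[OF T.norm_marginal_cf_le[OF j] le] by simp
    qed (use w h S.B_nonneg in auto)
    moreover define a where "a = deriv h 0"
    moreover have "exp (h 0) = 1"
      using w(2)[of 0] h(2)[of 0] by simp
    ultimately have wa: "w z = exp (a * z)" for z
      using h(2)[of z] by (metis exp_add mult_1)
    have "\<forall>\<^sub>F z in at 0. ?\<phi> j z \<noteq> 0"
      by (rule entire_eventually_nonzero[OF hol(1), of 0]) simp
    then obtain e where e: "e > 0" "\<And>z. norm z < e \<Longrightarrow> z \<noteq> 0 \<Longrightarrow> ?\<phi> j z \<noteq> 0"
      by (auto simp: eventually_at)
    \<comment> \<open>At this point the marginal is nonzero, so the equal moduli at \<open>s\<close>
      and \<open>- s\<close> can be compared through \<open>w\<close>, which gives
      \<open>Re a = 0\<close>.\<close>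
    define s where "s = e / 2"
    have s: "s > 0" "?\<phi> j (of_real s) \<noteq> 0"
      using e by (auto simp: s_def)
    have "norm (?\<phi>' j (- of_real s)) = norm (?\<phi>' j (of_real s))"
         "norm (?\<phi> j (- of_real s)) = norm (?\<phi> j (of_real s))"
      by (rule T.norm_marginal_cf_minus_real[OF j] S.norm_marginal_cf_minus_real[OF j])+
    then have "exp (Re (a * - of_real s)) = exp (Re (a * of_real s))"
      using s(2) unfolding w(2) wa norm_mult norm_exp_eq_Re by simp
    then have "Re a = 0"
      using s(1) by simp
    then have "a * z = \<i> * (z * of_real (Im a))" for z
      by (simp add: complex_eq_iff)
    then show ?thesis
      using w(2) wa by metis
  qed
  then obtain m where m: "\<And>j z. j < d \<Longrightarrow> ?\<phi>' j z = ?\<phi> j z * exp (\<i> * (z * of_real (m j)))"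
    by metis
  have "cf P' X' d t = exp (\<i> * (\<Sum>j<d. t j * of_real (m j))) * cf P X d t" for t
  proof -
    \<comment> \<open>The product of marginals to be cancelled may vanish at \<open>t\<close>
      itself, but it is 1 at the start of the segment from the origin to \<open>t\<close>.\<close>
    let ?D = "\<lambda>s. cf P' X' d (\<lambda>j. 0 + s * t j) - exp (\<i> * (\<Sum>j<d. s * t j * of_real (m j))) * cf P X d (\<lambda>j. 0 + s * t j)"
    let ?E = "\<lambda>s. \<Prod>j<d. ?\<phi> j (0 + s * t j)"
    have "?D 1 = 0"
    proof (rule entire_mult_eq_0[of ?D ?E 0])
      show "?D holomorphic_on UNIV" "?E holomorphic_on UNIV"
        by (intro holomorphic_intros S.cf_line_holomorphic T.cf_line_holomorphic
            holomorphic_on_prod S.marginal_cf_line_holomorphic)+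
      fix s
      have "(\<Prod>j<d. ?\<phi>' j (s * t j)) = (\<Prod>j<d. ?\<phi> j (s * t j)) * exp (\<i> * (\<Sum>j<d. s * t j * of_real (m j)))"
        by (simp add: m prod.distrib exp_sum[symmetric] sum_distrib_left)
      then show "?D s * ?E s = 0"
        using id[of "\<lambda>j. s * t j"] by (auto simp: algebra_simps)
    qed simp
    then show ?thesis by simp
  qed
  then show ?thesis by blast
qed

section \<open>The spherical parametrisation\<close>

interpretation lebn: product_sigma_finite "\<lambda>_::nat. lborel :: real measure"
  by standard

lemma measurable_lebn_component [measurable]: "i < n \<Longrightarrow> (\<lambda>u. u i) \<in> borel_measurable (lebn n)"
  unfolding lebn_def by measurable

lemma sph_angle_measurable [measurable]: "i < n \<Longrightarrow> (\<lambda>u. sph_angle u i) \<in> borel_measurable (lebn n)"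
  unfolding sph_angle_def by measurable

lemma sph_measurable [measurable]:
  assumes "j < d"
  shows "(\<lambda>u. sph d u j) \<in> borel_measurable (lebn (d - 1))"
proof -
  have "(\<lambda>u. sin (sph_angle u i)) \<in> borel_measurable (lebn (d - 1))" if "i < j" for i
    by (rule measurable_compose[OF sph_angle_measurable]) (use that assms in auto)
  then have "(\<lambda>u. \<Prod>i<j. sin (sph_angle u i)) \<in> borel_measurable (lebn (d - 1))"
    by (intro borel_measurable_prod) auto
  moreover have "(\<lambda>u. if j < d - 1 then cos (sph_angle u j) else 1) \<in> borel_measurable (lebn (d - 1))"
    using measurable_compose[OF sph_angle_measurable, of j "d - 1" cos borel] by (cases "j < d - 1") auto
  ultimately show ?thesis
    using assms by (simp add: sph_def)
qed

lemma sph_less: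
  assumes "j < d - 1"
  shows "sph d u j = (\<Prod>i<j. sin (sph_angle u i)) * cos (sph_angle u j)"
proof -
  have "j < d"
    using assms by simp
  with assms show ?thesis
    by (simp add: sph_def)
qed

lemma sph_last: "d > 0 \<Longrightarrow> sph d u (d - 1) = (\<Prod>i<d - 1. sin (sph_angle u i))"
  by (simp add: sph_def)

lemma abs_sph_le_1: "j < d \<Longrightarrow> \<bar>sph d u j\<bar> \<le> 1"
  by (simp add: sph_def abs_mult abs_prod mult_le_one prod_le_1 prod_nonneg)

text \<open>Backward induction, each step combining a cosine and a sine square. The case
  \<open>k = 0\<close> places the points on the unit sphere; general \<open>k\<close> supplies the
  normalising radii in \<open>sph_inv\<close>.\<close>

lemma sum_sph_power2_from:
  assumes d: "d \<ge> 1" and k: "k \<le> d - 1"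
  shows "(\<Sum>j\<in>{k..<d}. (sph d u j)\<^sup>2) = (\<Prod>i<k. sin (sph_angle u i))\<^sup>2"
  using k
proof (induction rule: inc_induct)
  case base
  have "{d - 1..<d} = {d - 1}"
    using d by auto
  then show ?case
    using d by (simp add: sph_def)
next
  case (step k)
  have "{k..<d} = insert k {Suc k..<d}"
    using step by auto
  then have "(\<Sum>j\<in>{k..<d}. (sph d u j)\<^sup>2) = (sph d u k)\<^sup>2 + (\<Prod>i<Suc k. sin (sph_angle u i))\<^sup>2"
    using step by simp
  also have "\<dots> = (\<Prod>i<k. sin (sph_angle u i))\<^sup>2 * ((cos (sph_angle u k))\<^sup>2 + (sin (sph_angle u k))\<^sup>2)"
    using step by (simp add: sph_less power_mult_distrib distrib_left del: sin_cos_squared_add sin_cos_squared_add2)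
  finally show ?case by simp
qed

lemma sum_sph_power2: "d \<ge> 1 \<Longrightarrow> (\<Sum>j<d. (sph d u j)\<^sup>2) = 1"
  using sum_sph_power2_from[of d 0 u] by (simp add: atLeast0LessThan)

section \<open>Null sets in the angular coordinates\<close>

lemma countable_trig_zeros:
  fixes a b c v :: real
  assumes ab: "a \<noteq> 0 \<or> b \<noteq> 0" and c: "c \<noteq> 0"
  shows "countable {y. a * cos (c * y) + b * sin (c * y) = v}"
proof -
  let ?F = "\<lambda>z. of_real a * cos (of_real c * z) + of_real b * sin (of_real c * z) - complex_of_real v"
  have F_real: "?F (of_real y) = of_real (a * cos (c * y) + b * sin (c * y) - v)" for y
    unfolding of_real_mult[symmetric] cos_of_real sin_of_real by simp
  have "\<exists>y. a * cos (c * y) + b * sin (c * y) - v \<noteq> 0"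
  proof (rule ccontr)
    assume "\<not> ?thesis"
    then have *: "a * cos (c * y) + b * sin (c * y) = v" for y by simp
    \<comment> \<open>The three points give \<open>v = a\<close>, \<open>v = - a\<close> and
      \<open>v = b\<close>.\<close>
    from *[of 0] *[of "pi / c"] *[of "pi / 2 / c"] show False
      using c ab by simp
  qed
  then obtain y where "?F (of_real y) \<noteq> 0"
    unfolding F_real of_real_eq_0_iff by blast
  then have "countable {z. ?F z = 0}"
    by (intro entire_countable_zeros) (auto intro!: holomorphic_intros)
  moreover have "?F (of_real y) = 0" if "a * cos (c * y) + b * sin (c * y) = v" for y
    unfolding F_real using that by simp
  then have "complex_of_real ` {y. a * cos (c * y) + b * sin (c * y) = v} \<subseteq> {z. ?F z = 0}"
    by blast
  ultimately have "countable (complex_of_real ` {y. a * cos (c * y) + b * sin (c * y) = v})"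
    using countable_subset by blast
  then show ?thesis
    by (rule countable_image_inj_on) (simp add: inj_on_def)
qed

text \<open>By Tonelli: integrating coordinate \<open>i\<close> first over a countable section
  already gives 0.\<close>

lemma lebn_null_set_of_countable_slices:
  assumes N: "N \<in> sets (lebn n)" and i: "i < n" and cnt: "\<And>x. countable {y. x(i := y) \<in> N}"
  shows "N \<in> null_sets (lebn n)"
proof -
  have ins: "insert i ({..<n} - {i}) = {..<n}"
    using i by auto
  have "emeasure (lebn n) N = (\<integral>\<^sup>+u. indicator N u \<partial>lebn n)"
    using N by simp
  also have "\<dots> = (\<integral>\<^sup>+x. (\<integral>\<^sup>+y. indicator N (x(i := y)) \<partial>lborel) \<partial>Pi\<^sub>M ({..<n} - {i}) (\<lambda>_. lborel))"
    using lebn.product_nn_integral_insert[of "{..<n} - {i}" i "indicator N"] N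
    unfolding ins lebn_def by simp
  also have "\<dots> = (\<integral>\<^sup>+x. 0 \<partial>Pi\<^sub>M ({..<n} - {i}) (\<lambda>_. lborel :: real measure))"
  proof (rule nn_integral_cong)
    fix x
    have "AE y in lborel. x(i := y) \<notin> N"
      using countable_imp_null_set_lborel[OF cnt[of x]] by (intro AE_I'[of "{y. x(i := y) \<in> N}"]) auto
    then have "(\<integral>\<^sup>+y. indicator N (x(i := y)) \<partial>lborel) = (\<integral>\<^sup>+y. 0 \<partial>(lborel :: real measure))"
      by (intro nn_integral_cong_AE) (auto simp: indicator_def)
    then show "(\<integral>\<^sup>+y. indicator N (x(i := y)) \<partial>lborel) = 0" by simp
  qed
  finally show ?thesis
    using N by auto
qed

lemma sph_angle_upd:
  "sph_angle (x(i := y)) l = (if l = i then (if i = 0 then 2 * pi else pi) * y else sph_angle x l)"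
  by (auto simp: sph_angle_def)

lemma AE_sin_sph_angle_nonzero: "AE u in lebn n. \<forall>i<n. sin (sph_angle u i) \<noteq> 0"
proof -
  have "AE u in lebn n. sin (sph_angle u i) \<noteq> 0" if i: "i < n" for i
  proof (rule AE_I')
    have [measurable]: "(\<lambda>u. sph_angle u i) \<in> borel_measurable (lebn n)"
      using i by simp
    show "{u \<in> space (lebn n). sin (sph_angle u i) = 0} \<in> null_sets (lebn n)"
    proof (rule lebn_null_set_of_countable_slices[OF _ i])
      show "{u \<in> space (lebn n). sin (sph_angle u i) = 0} \<in> sets (lebn n)" by measurable
      fix x :: "nat \<Rightarrow> real"
      show "countable {y. x(i := y) \<in> {u \<in> space (lebn n). sin (sph_angle u i) = 0}}"
        using countable_trig_zeros[of 0 1 "if i = 0 then 2 * pi else pi" 0]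
        by (rule countable_subset[rotated]) (auto simp: sph_angle_upd)
    qed
  qed auto
  then show ?thesis
    by (simp add: AE_all_countable)
qed

text \<open>With all angles but one fixed and the preceding sines nonzero, the form is a constant
  plus a nonzero combination of a cosine and a sine, which takes each value at countably many
  points. Geometrically, hyperplane sections of the sphere are negligible.\<close>

lemma AE_sph_linear_form_neq:
  assumes d: "d \<ge> 2" and m: "\<exists>j<d. m j \<noteq> 0"
  shows "AE u in lebn (d - 1). (\<Sum>j<d. m j * sph d u j) \<noteq> v"
proof -
  define k where "k = Max {j. j < d \<and> m j \<noteq> 0}"
  have fin: "finite {j. j < d \<and> m j \<noteq> 0}" and ne: "{j. j < d \<and> m j \<noteq> 0} \<noteq> {}"
    using m by auto
  have k: "k < d" "m k \<noteq> 0" and kmax: "\<And>j. j < d \<Longrightarrow> k < j \<Longrightarrow> m j = 0"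
    using Max_in[OF fin ne] Max_ge[OF fin] unfolding k_def by (auto simp: not_le[symmetric])
  \<comment> \<open>Coordinate \<open>k\<close> is governed by angle \<open>k\<close>, except that
    the last coordinate has no angle of its own and shares angle \<open>d - 2\<close> with its
    predecessor. As later coefficients vanish, no angle beyond \<open>i\<close> occurs in the
    form.\<close>
  define i where "i = min k (d - 2)"
  have i: "i < d - 1"
    using d by (auto simp: i_def)
  let ?N = "{u \<in> space (lebn (d - 1)). (\<forall>l<d - 1. sin (sph_angle u l) \<noteq> 0) \<and> (\<Sum>j<d. m j * sph d u j) = v}"
  have "?N \<in> null_sets (lebn (d - 1))"
  proof (rule lebn_null_set_of_countable_slices[OF _ i])
    have [measurable]: "(\<lambda>u. \<Sum>j<d. m j * sph d u j) \<in> borel_measurable (lebn (d - 1))"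
      by (intro borel_measurable_sum borel_measurable_times sph_measurable) auto
    have [measurable]: "Measurable.pred (lebn (d - 1)) (\<lambda>u. \<forall>l<d - 1. sin (sph_angle u l) \<noteq> 0)"
    proof -
      have "Measurable.pred (lebn (d - 1)) (\<lambda>u. l < d - 1 \<longrightarrow> sin (sph_angle u l) \<noteq> 0)" for l
        using measurable_compose[OF sph_angle_measurable, of l "d - 1" sin borel] by (cases "l < d - 1") auto
      then show ?thesis
        by measurable
    qed
    show "?N \<in> sets (lebn (d - 1))" by measurable
    fix x :: "nat \<Rightarrow> real"
    define p where "p = (\<Prod>l<i. sin (sph_angle x l))"
    define c where "c = (if i = 0 then 2 * pi else pi)"
    \<comment> \<open>A sine of the free angle can come only from the last coordinate, hence only
      when the free angle is the last one.\<close>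
    define b where "b = (if i = d - 2 then m (Suc i) * p else 0)"
    define w where "w = (\<Sum>j<i. m j * sph d x j)"
    have form: "(\<Sum>j<d. m j * sph d (x(i := y)) j) = w + (m i * p * cos (c * y) + b * sin (c * y))" for y
    proof -
      let ?u = "x(i := y)"
      have prods: "(\<Prod>l<j. sin (sph_angle ?u l)) = (\<Prod>l<j. sin (sph_angle x l))" if "j \<le> i" for j
        using that by (intro prod.cong) (auto simp: sph_angle_upd)
      have small: "sph d ?u j = sph d x j" if "j < i" for j
        using that prods[of j] i by (simp add: sph_less sph_angle_upd)
      have "sph d ?u i = p * cos (c * y)"
        using i prods[of i] by (simp add: sph_less sph_angle_upd p_def c_def)
      moreover have "m (Suc i) * sph d ?u (Suc i) = b * sin (c * y)"
      proof (cases "i = d - 2")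
        case True
        then have "Suc i = d - 1"
          using d by simp
        then have "sph d ?u (Suc i) = (\<Prod>l<Suc i. sin (sph_angle ?u l))"
          using d sph_last[of d ?u] by simp
        with True show ?thesis
          using prods[of i] by (simp add: sph_angle_upd p_def c_def b_def)
      next
        case False
        then have "m (Suc i) = 0"
          using kmax[of "Suc i"] by (auto simp: i_def)
        with False show ?thesis
          by (simp add: b_def)
      qed
      moreover have "(\<Sum>j<d. m j * sph d ?u j) = (\<Sum>j<Suc (Suc i). m j * sph d ?u j)"
      proof (rule sum.mono_neutral_right)
        show "\<forall>j\<in>{..<d} - {..<Suc (Suc i)}. m j * sph d ?u j = 0"
          using kmax by (auto simp: i_def min_def split: if_splits)
      qed (use i in auto)
      moreover have "(\<Sum>j<i. m j * sph d ?u j) = w"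
        unfolding w_def by (intro sum.cong refl) (simp add: small)
      ultimately show ?thesis
        by simp
    qed
    show "countable {y. x(i := y) \<in> ?N}"
    proof (cases "p = 0")
      \<comment> \<open>A vanishing earlier sine is excluded by the definition of \<open>?N\<close>,
        so the section is empty.\<close>
      case True
      then obtain l where l: "l < i" "sin (sph_angle x l) = 0"
        by (auto simp: p_def)
      then have "{y. x(i := y) \<in> ?N} = {}"
        using i by (auto simp: sph_angle_upd intro!: exI[of _ l])
      then show ?thesis by (simp only: countable_empty)
    next
      case False
      have "m i * p \<noteq> 0 \<or> b \<noteq> 0"
      proof (cases "k \<le> d - 2")
        case True
        then show ?thesis
          using k False by (simp add: i_def)
      next
        case le: False
        then have "i = d - 2" "k = Suc i"
          using k d by (auto simp: i_def)
        then show ?thesis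
          using k False by (simp add: b_def)
      qed
      then have "countable {y. m i * p * cos (c * y) + b * sin (c * y) = v - w}"
        by (intro countable_trig_zeros) (auto simp: c_def)
      then show ?thesis
        by (rule countable_subset[rotated]) (auto simp: form)
    qed
  qed
  then have "AE u in lebn (d - 1). u \<notin> ?N"
    by (rule AE_not_in)
  with AE_sin_sph_angle_nonzero[of "d - 1"] AE_space show ?thesis
    by eventually_elim auto
qed

lemma AE_sph_neq:
  assumes "d \<ge> 2" "j < d"
  shows "AE u in lebn (d - 1). sph d u j \<noteq> v"
proof -
  have "(\<Sum>l<d. (if l = j then 1 else 0) * sph d u l) = sph d u j" for u
    using assms by (simp add: if_distrib[of "\<lambda>x. x * _"] cong: if_cong)
  with AE_sph_linear_form_neq[of d "\<lambda>l. if l = j then 1 else 0" v] assms show ?thesis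
    by auto
qed

section \<open>A measurable left inverse of the parametrisation\<close>

definition clamped_arccos :: "real \<Rightarrow> real" where
  "clamped_arccos x = arccos (max (- 1) (min 1 x))"

lemma clamped_arccos_measurable [measurable]: "clamped_arccos \<in> borel_measurable borel"
  unfolding clamped_arccos_def
  by (intro borel_measurable_continuous_onI continuous_intros) auto

lemma clamped_arccos_cos: "0 \<le> x \<Longrightarrow> x \<le> pi \<Longrightarrow> clamped_arccos (cos x) = x"
  by (simp add: clamped_arccos_def arccos_cos)

text \<open>The first angle runs over a full circle, so its cosine leaves two candidates. The other
  sines are nonnegative on the cube, hence the last coordinate has the sign of
  \<open>sin (2 * pi * u 0)\<close> and selects the branch. For \<open>i > 0\<close> the square root
  is the absolute value of the product of the preceding sines, and the same sign turns the quotient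
  into \<open>cos (pi * u i)\<close>.\<close>

definition sph_inv :: "nat \<Rightarrow> (nat \<Rightarrow> real) \<Rightarrow> nat \<Rightarrow> real" where
  "sph_inv d x = (\<lambda>i\<in>{..<d - 1}.
     if i = 0 then (if x (d - 1) > 0 then clamped_arccos (x 0) / (2 * pi) else 1 - clamped_arccos (x 0) / (2 * pi))
     else clamped_arccos ((if x (d - 1) > 0 then 1 else - 1) * x i / sqrt (\<Sum>k\<in>{i..<d}. (x k)\<^sup>2)) / pi)"

lemma sph_inv_measurable [measurable]:
  assumes d: "d \<ge> 2"
  shows "sph_inv d \<in> Rd d \<rightarrow>\<^sub>M lebn (d - 1)"
proof -
  have c [measurable]: "(\<lambda>x. x j) \<in> borel_measurable (Rd d)" if "j < d" for j
    unfolding Rd_def using that by (intro measurable_component_singleton) simp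
  have [measurable]: "(\<lambda>x. x (d - 1)) \<in> borel_measurable (Rd d)" "(\<lambda>x. x 0) \<in> borel_measurable (Rd d)"
    using d by (auto intro: c)
  have [measurable]: "(\<lambda>x. \<Sum>k\<in>{i..<d}. (x k)\<^sup>2) \<in> borel_measurable (Rd d)" for i
    by (intro borel_measurable_sum borel_measurable_power c) auto
  show ?thesis
    unfolding lebn_def sph_inv_def
  proof (rule measurable_restrict)
    fix i assume "i \<in> {..<d - 1}"
    then have [measurable]: "(\<lambda>x. x i) \<in> borel_measurable (Rd d)"
      by (auto intro: c)
    show "(\<lambda>x. if i = 0 then (if x (d - 1) > 0 then clamped_arccos (x 0) / (2 * pi) else 1 - clamped_arccos (x 0) / (2 * pi))
       else clamped_arccos ((if x (d - 1) > 0 then 1 else - 1) * x i / sqrt (\<Sum>k\<in>{i..<d}. (x k)\<^sup>2)) / pi)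
       \<in> Rd d \<rightarrow>\<^sub>M lborel"
      by measurable
  qed
qed

lemma sph_inv_sph:
  assumes d: "d \<ge> 2" and u: "u \<in> cube (d - 1) 0 1" and nz: "\<And>i. i < d - 1 \<Longrightarrow> sin (sph_angle u i) \<noteq> 0"
  shows "sph_inv d (sph d u) = u"
proof -
  have u01: "0 \<le> u i" "u i \<le> 1" if "i < d - 1" for i
    using u that by (auto simp: cube_def PiE_def Pi_def)
  have uext: "u i = undefined" if "\<not> i < d - 1" for i
    using u that by (auto simp: cube_def PiE_def extensional_def)
  have pos: "sin (sph_angle u i) > 0" if "i < d - 1" "i > 0" for i
  proof -
    have "sin (sph_angle u i) \<ge> 0"
      using that u01[of i] by (auto simp: sph_angle_def intro!: sin_ge_zero)
    with nz[of i] that show ?thesis by simp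
  qed
  define p where "p i = (\<Prod>l<i. sin (sph_angle u l))" for i
  define q where "q i = (\<Prod>l\<in>{1..<i}. sin (sph_angle u l))" for i
  have pq: "p i = sin (sph_angle u 0) * q i" if "i > 0" for i
  proof -
    have "{..<i} = insert 0 {1..<i}"
      using that by auto
    then show ?thesis
      by (simp add: p_def q_def)
  qed
  have qpos: "q i > 0" if "i \<le> d - 1" for i
    unfolding q_def using that pos by (intro prod_pos) auto
  have last: "sph d u (d - 1) = p (d - 1)"
    using d by (simp add: sph_def p_def)
  have sgn: "sph d u (d - 1) > 0 \<longleftrightarrow> sin (sph_angle u 0) > 0"
    using d qpos[of "d - 1"] unfolding last by (simp add: pq zero_less_mult_iff)
  have r: "sqrt (\<Sum>k\<in>{i..<d}. (sph d u k)\<^sup>2) = \<bar>p i\<bar>" if "i < d - 1" for i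
    using sum_sph_power2_from[of d i u] d that by (simp add: p_def)
  have si: "sph d u i = p i * cos (sph_angle u i)" if "i < d - 1" for i
    using that by (simp add: sph_less p_def)
  have "sph_inv d (sph d u) i = u i" for i
  proof (cases "i < d - 1")
    case False
    then show ?thesis
      by (simp add: sph_inv_def uext)
  next
    case i: True
    show ?thesis
    proof (cases "i = 0")
      case True
      have s0: "sph d u 0 = cos (2 * pi * u 0)"
        using i si[of 0] True by (simp add: p_def sph_angle_def)
      have a0: "sph_angle u 0 = 2 * pi * u 0"
        by (simp add: sph_angle_def)
      show ?thesis
      proof (cases "u 0 \<le> 1 / 2")
        case le: True
        then have "sin (sph_angle u 0) > 0"
          using nz[of 0] u01[of 0] i True sin_ge_zero[of "2 * pi * u 0"] by (auto simp: a0 less_le)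
        moreover have "clamped_arccos (cos (2 * pi * u 0)) = 2 * pi * u 0"
          using le u01[of 0] i True by (intro clamped_arccos_cos) auto
        ultimately show ?thesis
          using i True sgn by (simp add: sph_inv_def s0)
      next
        case gt: False
        \<comment> \<open>Reflecting \<open>u 0\<close> to \<open>1 - u 0\<close> brings the angle
          back into the range of \<open>arccos\<close>.\<close>
        have e: "cos (2 * pi * u 0) = cos (2 * pi * (1 - u 0))" "sin (2 * pi * u 0) = - sin (2 * pi * (1 - u 0))"
          by (simp_all add: right_diff_distrib cos_diff sin_diff)
        have "sin (2 * pi * (1 - u 0)) \<ge> 0"
          using gt u01[of 0] i True by (intro sin_ge_zero) auto
        then have "\<not> sin (sph_angle u 0) > 0"
          unfolding a0 e by simp
        moreover have "clamped_arccos (cos (2 * pi * (1 - u 0))) = 2 * pi * (1 - u 0)"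
          using gt u01[of 0] i True by (intro clamped_arccos_cos) auto
        ultimately show ?thesis
          using i True sgn by (simp add: sph_inv_def s0 e(1))
      qed
    next
      case False
      let ?\<sigma> = "if sph d u (d - 1) > 0 then 1 else - 1 :: real"
      have p: "\<bar>p i\<bar> = ?\<sigma> * p i"
        using qpos[of i] i False nz[of 0] unfolding sgn by (auto simp: pq abs_mult)
      have pnz: "p i \<noteq> 0"
        using qpos[of i] i False nz[of 0] by (auto simp: pq)
      have "?\<sigma> * sph d u i / \<bar>p i\<bar> = cos (pi * u i)"
        unfolding p si[OF i] using pnz False by (simp add: sph_angle_def)
      moreover have "clamped_arccos (cos (pi * u i)) = pi * u i"
        using u01[OF i] by (intro clamped_arccos_cos) auto
      ultimately show ?thesis
        using i False by (simp add: sph_inv_def r[OF i])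
    qed
  qed
  then show ?thesis by blast
qed

section \<open>Nondegeneracy of the spherical signal\<close>

lemma density_measurable: "is_density n f \<Longrightarrow> (\<lambda>u. f u * indicator (cube n 0 1) u) \<in> borel_measurable (lebn n)"
  by (simp add: is_density_def)

lemma density_nonneg: "is_density n f \<Longrightarrow> 0 \<le> f u * indicator (cube n 0 1) u"
  by (auto simp: is_density_def indicator_def)

lemma prob_space_U_law:
  assumes "is_density n f"
  shows "prob_space (U_law n f)"
proof (rule prob_spaceI)
  have [measurable]: "(\<lambda>u. f u * indicator (cube n 0 1) u) \<in> borel_measurable (lebn n)"
    by (rule density_measurable[OF assms])
  show "emeasure (U_law n f) (space (U_law n f)) = 1"
    using assms by (simp add: U_law_def emeasure_density is_density_def cong: nn_integral_cong)
qed

lemma sets_U_law [simp, measurable_cong]: "sets (U_law n f) = sets (lebn n)"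
  by (simp add: U_law_def)

lemma AE_U_law:
  assumes "is_density n f" "AE u in lebn n. Q u"
  shows "AE u in U_law n f. Q u"
  unfolding U_law_def
  by (subst AE_density) (use assms density_measurable in auto)

lemma integral_U_law:
  fixes g :: "(nat \<Rightarrow> real) \<Rightarrow> complex"
  assumes f: "is_density n f" and g: "g \<in> borel_measurable (lebn n)"
  shows "(\<integral>u. g u \<partial>U_law n f) = (\<integral>u. of_real (f u * indicator (cube n 0 1) u) * g u \<partial>lebn n)"
  unfolding U_law_def
  by (subst integral_density) (use assms density_measurable density_nonneg in \<open>auto simp: scaleR_conv_of_real\<close>)

lemma bounded_signal_sph:
  assumes f: "is_density (d - 1) f" and R: "R \<ge> 0"
  shows "bounded_signal (U_law (d - 1) f) (\<lambda>j u. R * sph d u j) d R"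
proof (rule bounded_signal.intro[OF prob_space_U_law[OF f]], unfold_locales)
  fix j assume j: "j < d"
  show "(\<lambda>u. R * sph d u j) \<in> borel_measurable (U_law (d - 1) f)"
    using sph_measurable[OF j] by (simp cong: measurable_cong_sets)
  show "\<bar>R * sph d u j\<bar> \<le> R" for u
    using abs_sph_le_1[OF j, of u] R by (simp add: abs_mult mult_left_le)
qed fact

lemma norm_sin_complex_le: "norm (sin z) \<le> exp (norm (z :: complex))"
proof -
  have "norm (sin z) = norm (exp (\<i> * z) - exp (- (\<i> * z))) / 2"
    by (simp add: sin_exp_eq norm_divide norm_mult)
  also have "\<dots> \<le> (norm (exp (\<i> * z)) + norm (exp (- (\<i> * z)))) / 2"
    by (intro divide_right_mono norm_triangle_ineq4) simp
  also have "\<dots> \<le> (exp (norm z) + exp (norm z)) / 2"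
    using norm_exp[of "\<i> * z"] norm_exp[of "- (\<i> * z)"] by (intro divide_right_mono add_mono) (auto simp: norm_mult)
  finally show ?thesis by simp
qed

text \<open>Expanding the sine gives
  \<open>(exp (2 * \<i> * Re w) - exp (- 2 * Im w)) / (2 * \<i>)\<close>, whose second part is
  purely imaginary. A further factor \<open>sin (2 * Re w)\<close> turns the real part into half a
  square, which provides positivity.\<close>

lemma Re_exp_times_sin_cnj:
  fixes w :: complex
  shows "Re (exp (\<i> * w) * sin (cnj w)) = sin (2 * Re w) / 2"
proof -
  obtain p q where w: "w = Complex p q"
    by (cases w)
  have c: "exp (-q) * (exp (-q) + exp q) = exp (-q) * exp (-q) + 1" "exp (-q) * (exp (-q) - exp q) = exp (-q) * exp (-q) - 1"
    by (simp_all add: distrib_left right_diff_distrib exp_add[symmetric])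
  have "Re (exp (\<i> * w) * sin (cnj w)) = exp (-q) * cos p * (sin p * (exp (-q) + exp q) / 2)
          - exp (-q) * sin p * (cos p * (exp (-q) - exp q) / 2)"
    by (simp add: w Re_exp Im_exp Re_sin Im_sin)
  also have "\<dots> = cos p * sin p / 2 * (exp (-q) * (exp (-q) + exp q) - exp (-q) * (exp (-q) - exp q))"
    by (simp add: field_simps)
  also have "\<dots> = sin p * cos p"
    unfolding c by simp
  finally show ?thesis
    by (simp add: w sin_double)
qed

text \<open>The squared coordinate \<open>X\<^sub>j\<^sup>2\<close> is a function of the other coordinates, hence so is
  \<open>sin (cnj z X\<^sub>j) sin (2 Re z X\<^sub>j)\<close>, which is even in \<open>X\<^sub>j\<close>. Testing against this function shows that
  a degenerate \<open>z\<close> would make \<open>sin (2 Re z X\<^sub>j)\<close> vanish almost surely.\<close>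

lemma sph_cf_nondegenerate:
  assumes d: "d \<ge> 2" and f: "is_density (d - 1) f" and R: "R \<ge> 0" and j: "j < d"
  shows "\<exists>t. t j = z \<and> cf (U_law (d - 1) f) (\<lambda>j u. R * sph d u j) d t \<noteq> 0"
proof (rule ccontr)
  let ?P = "U_law (d - 1) f" and ?X = "\<lambda>j u. R * sph d u j"
  interpret bounded_signal ?P ?X d R
    by (rule bounded_signal_sph[OF f R])
  assume "\<not> ?thesis"
  then have zero: "cf ?P ?X d t = 0" if "t j = z" for t
    using that by blast
  have Xj [measurable]: "?X j \<in> borel_measurable ?P"
    by (rule X_measurable[OF j])
  define x where "x = Re z"
  show False
  proof (cases "x = 0 \<or> R = 0")
    \<comment> \<open>The test function would vanish identically here; instead the exponential is
      real and bounded below by a positive constant, so its integral cannot be 0.\<close>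
    case True
    have "marginal_cf ?P ?X d j z = 0"
      unfolding marginal_cf_def by (rule zero) simp
    moreover have "exp (\<i> * (z * of_real (?X j u))) = complex_of_real (exp (- Im z * ?X j u))" for u
      using True by (auto simp: x_def exp_of_real[symmetric] complex_eq_iff Re_exp Im_exp)
    ultimately have int0: "(\<integral>u. exp (- Im z * ?X j u) \<partial>?P) = 0"
      unfolding marginal_cf_eq[OF j] by simp
    have b: "\<bar>Im z * ?X j u\<bar> \<le> \<bar>Im z\<bar> * R" for u
      using X_bounded[OF j, of u] by (simp add: abs_mult mult_left_mono)
    have "exp (- \<bar>Im z\<bar> * R) = (\<integral>u. exp (- \<bar>Im z\<bar> * R) \<partial>?P)"
      using prob_space by simp
    also have "\<dots> \<le> (\<integral>u. exp (- Im z * ?X j u) \<partial>?P)"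
    proof (intro integral_mono integrable_const integrable_const_bound[where B = "exp (\<bar>Im z\<bar> * R)"])
      show "exp (- \<bar>Im z\<bar> * R) \<le> exp (- Im z * ?X j u)" for u
        using b[of u] by (simp only: exp_le_cancel_iff)
      show "AE u in ?P. norm (exp (- Im z * ?X j u)) \<le> exp (\<bar>Im z\<bar> * R)"
      proof (intro AE_I2)
        fix u show "norm (exp (- Im z * ?X j u)) \<le> exp (\<bar>Im z\<bar> * R)"
          using abs_le_D2[OF b[of u]] by (simp only: mult_minus_left real_norm_def abs_exp_cancel exp_le_cancel_iff)
      qed
    qed measurable
    finally show False
      using int0 by (simp add: not_le[symmetric])
  next
    case False
    then have x0: "x \<noteq> 0" and R0: "R > 0"
      using R by auto
    let ?Y = "\<lambda>l u. if l = j then 0 else ?X l u"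
    \<comment> \<open>On the sphere this returns \<open>|X j|\<close> from the other coordinates.
      Truncation at 0 keeps it between 0 and \<open>R\<close> for every argument, so that
      \<open>G\<close> is bounded.\<close>
    define c where "c y = sqrt (max 0 (R\<^sup>2 - (\<Sum>l<d. (y l)\<^sup>2)))" for y :: "nat \<Rightarrow> real"
    define G where "G y = sin (cnj z * of_real (c y)) * sin (of_real (2 * x * c y))" for y
    have comp: "(\<lambda>y. y l) \<in> borel_measurable (Rd d)" if "l < d" for l
      unfolding Rd_def using that by (intro measurable_component_singleton) simp
    have [measurable]: "(\<lambda>y. \<Sum>l<d. (y l)\<^sup>2) \<in> borel_measurable (Rd d)"
      by (intro borel_measurable_sum borel_measurable_power comp) auto
    have [measurable]: "sin \<in> borel_measurable (borel :: complex measure)"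
      by (intro borel_measurable_continuous_onI continuous_intros)
    have Gm: "G \<in> borel_measurable (Rd d)"
      unfolding G_def c_def by measurable
    have cb: "0 \<le> c y" "c y \<le> R" for y
    proof -
      have "max 0 (R\<^sup>2 - (\<Sum>l<d. (y l)\<^sup>2)) \<le> R\<^sup>2"
        by (simp add: sum_nonneg)
      then show "c y \<le> R"
        unfolding c_def using R real_le_lsqrt by blast
    qed (simp add: c_def)
    have Gb: "norm (G y) \<le> exp (norm z * R) * exp (norm (of_real (2 * x) :: complex) * R)" for y
    proof -
      have "norm (sin (w * of_real (c y))) \<le> exp (norm w * R)" for w :: complex
        by (rule order_trans[OF norm_sin_complex_le]) (use cb[of y] in \<open>simp add: norm_mult mult_left_mono\<close>)
      from this[of "cnj z"] this[of "of_real (2 * x)"] show ?thesis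
        unfolding G_def norm_mult by (intro mult_mono) (auto simp: norm_mult)
    qed
    \<comment> \<open>The complex frequency \<open>z\<close> becomes the weight while the other
      frequencies are kept real: this is degeneracy at \<open>z\<close> in the form of
      \<open>Fourier_zero\<close>.\<close>
    let ?h = "\<lambda>u. exp (\<i> * (z * of_real (?X j u)))"
    have hint: "integrable ?P ?h"
      using cf_integrable[of "(\<lambda>_. 0)(j := z)"] j by (simp add: if_distrib[of "\<lambda>x. x * _"] cong: if_cong)
    have zero': "(\<integral>u. ?h u * iexp (\<Sum>l<d. t l * ?Y l u) \<partial>?P) = 0" for t
    proof -
      let ?t = "(\<lambda>l. complex_of_real (t l))(j := z)"
      have "?h u * iexp (\<Sum>l<d. t l * ?Y l u) = exp (\<i> * (\<Sum>l<d. ?t l * of_real (?X l u)))" for u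
      proof -
        have "(\<Sum>l<d. ?t l * of_real (?X l u)) = z * of_real (?X j u) + (\<Sum>l\<in>{..<d} - {j}. ?t l * of_real (?X l u))"
          using j by (subst sum.remove[of _ j]) auto
        also have "(\<Sum>l\<in>{..<d} - {j}. ?t l * of_real (?X l u)) = of_real (\<Sum>l\<in>{..<d} - {j}. t l * ?Y l u)"
          unfolding of_real_sum by (intro sum.cong refl) auto
        also have "(\<Sum>l\<in>{..<d} - {j}. t l * ?Y l u) = (\<Sum>l<d. t l * ?Y l u)"
          using j by (subst (2) sum.remove[of _ j]) auto
        finally show ?thesis
          by (simp only: distrib_left exp_add)
      qed
      then show ?thesis
        using zero[of ?t] unfolding cf_def by simp
    qed
    have Z: "(\<integral>u. ?h u * G (\<lambda>l\<in>{..<d}. ?Y l u) \<partial>?P) = 0"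
    proof (rule Fourier_zero[OF hint _ zero' Gm Gb])
      fix l assume "l < d"
      then show "?Y l \<in> borel_measurable ?P"
        using X_measurable[of l] by (cases "l = j") auto
    qed
    have GX: "G (\<lambda>l\<in>{..<d}. ?Y l u) = sin (cnj z * of_real (?X j u)) * sin (of_real (2 * x * ?X j u))" for u
    proof -
      have "(\<Sum>l<d. ((\<lambda>l\<in>{..<d}. ?Y l u) l)\<^sup>2) = (\<Sum>l\<in>{..<d} - {j}. (?X l u)\<^sup>2)"
        using j by (subst sum.remove[of _ j]) (auto intro!: sum.cong)
      also have "\<dots> = (\<Sum>l<d. (?X l u)\<^sup>2) - (?X j u)\<^sup>2"
        using j by (subst (2) sum.remove[of _ j]) auto
      also have "(\<Sum>l<d. (?X l u)\<^sup>2) = R\<^sup>2"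
        using sum_sph_power2[of d u] d by (simp add: power_mult_distrib sum_distrib_left[symmetric])
      finally have "c (\<lambda>l\<in>{..<d}. ?Y l u) = \<bar>?X j u\<bar>"
        by (simp add: c_def)
      then have "c (\<lambda>l\<in>{..<d}. ?Y l u) = ?X j u \<or> c (\<lambda>l\<in>{..<d}. ?Y l u) = - ?X j u"
        by linarith
      then show ?thesis
        unfolding G_def by (elim disjE) simp_all
    qed
    have Re_eq: "Re (?h u * G (\<lambda>l\<in>{..<d}. ?Y l u)) = (sin (2 * x * ?X j u))\<^sup>2 / 2" for u
    proof -
      have "?h u * G (\<lambda>l\<in>{..<d}. ?Y l u)
          = (exp (\<i> * (z * of_real (?X j u))) * sin (cnj (z * of_real (?X j u)))) * of_real (sin (2 * x * ?X j u))"
        unfolding GX sin_of_real by simp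
      also have "Re \<dots> = Re (exp (\<i> * (z * of_real (?X j u))) * sin (cnj (z * of_real (?X j u)))) * sin (2 * x * ?X j u)"
        by simp
      also have "\<dots> = (sin (2 * x * ?X j u))\<^sup>2 / 2"
        unfolding Re_exp_times_sin_cnj by (simp add: x_def power2_eq_square mult.assoc)
      finally show ?thesis .
    qed
    have YR [measurable]: "(\<lambda>u. \<lambda>l\<in>{..<d}. ?Y l u) \<in> ?P \<rightarrow>\<^sub>M Rd d"
      unfolding Rd_def
    proof (rule measurable_restrict)
      fix l assume "l \<in> {..<d}"
      then show "?Y l \<in> borel_measurable ?P"
        using X_measurable[of l] by (cases "l = j") auto
    qed
    have hb: "norm (?h u) \<le> exp (norm z * R)" for u
      by (rule order_trans[OF norm_exp])
         (use X_bounded[OF j, of u] in \<open>simp add: norm_mult mult_left_mono\<close>)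
    have GI: "integrable ?P (\<lambda>u. ?h u * G (\<lambda>l\<in>{..<d}. ?Y l u))"
    proof (rule integrable_const_bound)
      show "AE u in ?P. norm (?h u * G (\<lambda>l\<in>{..<d}. ?Y l u)) \<le>
          exp (norm z * R) * (exp (norm z * R) * exp (norm (of_real (2 * x) :: complex) * R))"
        unfolding norm_mult using hb Gb by (intro AE_I2 mult_mono) auto
      show "(\<lambda>u. ?h u * G (\<lambda>l\<in>{..<d}. ?Y l u)) \<in> borel_measurable ?P"
        using measurable_compose[OF YR Gm] hint by (intro borel_measurable_times) auto
    qed
    from integral_Re[OF GI] have "(\<integral>u. (sin (2 * x * ?X j u))\<^sup>2 / 2 \<partial>?P) = 0"
      unfolding Re_eq Z by simp
    moreover have "integrable ?P (\<lambda>u. (sin (2 * x * ?X j u))\<^sup>2 / 2)"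
      using integrable_Re[OF GI] unfolding Re_eq .
    ultimately have "AE u in ?P. (sin (2 * x * ?X j u))\<^sup>2 / 2 = 0"
      by (subst (asm) integral_nonneg_eq_0_iff_AE) auto
    moreover have "AE u in ?P. sin (2 * x * ?X j u) \<noteq> 0"
    proof (rule AE_U_law[OF f])
      \<comment> \<open>The sine has countably many zeros, and each is attained by the coordinate
        only on a null set of angles.\<close>
      let ?Z = "{y. 0 * cos (2 * x * R * y) + 1 * sin (2 * x * R * y) = 0}"
      have "countable ?Z"
        using x0 R0 by (intro countable_trig_zeros) auto
      then have "AE u in lebn (d - 1). \<forall>v\<in>?Z. sph d u j \<noteq> v"
        by (subst AE_ball_countable) (use AE_sph_neq[OF d j] in auto)
      then show "AE u in lebn (d - 1). sin (2 * x * ?X j u) \<noteq> 0"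
        by eventually_elim (auto simp: mult.assoc)
    qed
    ultimately have "AE u in ?P. False"
      by eventually_elim simp
    then show False
      by simp
  qed
qed

section \<open>Identification\<close>

lemma integral_prod_pair:
  fixes g :: "'a \<Rightarrow> complex" and k :: "'b \<Rightarrow> complex"
  assumes M: "prob_space M" and N: "prob_space N"
    and [measurable]: "g \<in> borel_measurable M" "k \<in> borel_measurable N"
    and gb: "\<And>x. norm (g x) \<le> 1" and kb: "\<And>y. norm (k y) \<le> 1"
  shows "(\<integral>z. g (fst z) * k (snd z) \<partial>(M \<Otimes>\<^sub>M N)) = (\<integral>x. g x \<partial>M) * (\<integral>y. k y \<partial>N)"
proof -
  interpret M: prob_space M by fact
  interpret N: prob_space N by fact
  interpret MN: pair_prob_space M N ..
  have "integrable (M \<Otimes>\<^sub>M N) (\<lambda>z. g (fst z) * k (snd z))"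
    by (rule MN.integrable_const_bound[where B = 1])
       (use gb kb in \<open>auto simp: norm_mult intro!: mult_le_one\<close>)
  from MN.integral_fst'[OF this] show ?thesis by simp
qed

lemma iexp_sum: "iexp (\<Sum>j\<in>A. g j) = (\<Prod>j\<in>A. iexp (g j))"
  by (cases "finite A") (simp_all add: sum_distrib_left exp_sum)

text \<open>Every index carries a distribution so that the product locale applies; indices from
  \<open>d\<close> on do not affect \<open>law d\<close>.\<close>

locale noise =
  fixes Q :: "nat \<Rightarrow> real measure"
  assumes Q_dist: "real_distribution (Q j)"
begin

sublocale Q: real_distribution "Q j" for j
  by (rule Q_dist)

sublocale product_prob_space Q UNIV
  by unfold_locales

abbreviation law :: "nat \<Rightarrow> (nat \<Rightarrow> real) measure" where
  "law d \<equiv> \<Pi>\<^sub>M j\<in>{..<d}. Q j"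

lemma sets_law [measurable_cong]: "sets (law d) = sets (Rd d)"
  unfolding Rd_def by (intro sets_PiM_cong) auto

lemma prob_space_law: "prob_space (law d)"
  by (intro prob_space_PiM Q.prob_space_axioms)

lemma law_component [measurable]: "j < d \<Longrightarrow> (\<lambda>e. e j) \<in> borel_measurable (law d)"
  using measurable_component_singleton[of j "{..<d}" Q] by (simp cong: measurable_cong_sets)

lemma Fourier_law: "(\<integral>e. iexp (\<Sum>j<d. t j * e j) \<partial>law d) = (\<Prod>j<d. char (Q j) (t j))"
proof -
  have "(\<integral>e. iexp (\<Sum>j<d. t j * e j) \<partial>law d) = (\<integral>e. (\<Prod>j<d. iexp (t j * e j)) \<partial>law d)"
    by (simp only: iexp_sum)
  also have "\<dots> = (\<Prod>j<d. char (Q j) (t j))"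
    unfolding char_def by (rule product_integral_prod) (auto intro!: Q.integrable_iexp)
  finally show ?thesis .
qed

text \<open>The centre contributes one exponential factor per coordinate and is grouped with the
  noise: this is the source of the ambiguity between centre and noise.\<close>

lemma Fourier_model:
  assumes f: "is_density (d - 1) f" and R: "R \<ge> 0"
  shows "(\<integral>z. iexp (\<Sum>j<d. t j * (C j + R * sph d (fst z) j + snd z j)) \<partial>(U_law (d - 1) f \<Otimes>\<^sub>M law d))
    = cf (U_law (d - 1) f) (\<lambda>j u. R * sph d u j) d (\<lambda>j. of_real (t j)) *
      (\<Prod>j<d. iexp (t j * C j) * char (Q j) (t j))"
proof -
  interpret bounded_signal "U_law (d - 1) f" "\<lambda>j u. R * sph d u j" d R
    by (rule bounded_signal_sph[OF f R])
  let ?g = "\<lambda>u. iexp (\<Sum>j<d. t j * (R * sph d u j))"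
  let ?k = "\<lambda>e. iexp (\<Sum>j<d. t j * e j)"
  have [measurable]: "(\<lambda>u. \<Sum>j<d. t j * (R * sph d u j)) \<in> borel_measurable (U_law (d - 1) f)"
    by (intro borel_measurable_sum borel_measurable_times X_measurable) auto
  have [measurable]: "(\<lambda>e. \<Sum>j<d. t j * e j) \<in> borel_measurable (law d)"
    by (intro borel_measurable_sum borel_measurable_times law_component) auto
  have "iexp (\<Sum>j<d. t j * (C j + R * sph d (fst z) j + snd z j))
      = iexp (\<Sum>j<d. t j * C j) * (?g (fst z) * ?k (snd z))" for z :: "(nat \<Rightarrow> real) \<times> (nat \<Rightarrow> real)"
  proof -
    have "(\<Sum>j<d. t j * (C j + R * sph d (fst z) j + snd z j))
      = (\<Sum>j<d. t j * C j) + (\<Sum>j<d. t j * (R * sph d (fst z) j)) + (\<Sum>j<d. t j * snd z j)"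
      by (simp add: distrib_left sum.distrib)
    then show ?thesis
      by (simp only: of_real_add distrib_left exp_add mult.assoc)
  qed
  then have "(\<integral>z. iexp (\<Sum>j<d. t j * (C j + R * sph d (fst z) j + snd z j)) \<partial>(U_law (d - 1) f \<Otimes>\<^sub>M law d))
      = iexp (\<Sum>j<d. t j * C j) * (\<integral>z. ?g (fst z) * ?k (snd z) \<partial>(U_law (d - 1) f \<Otimes>\<^sub>M law d))"
    by (simp only: integral_mult_right_zero)
  also have "(\<integral>z. ?g (fst z) * ?k (snd z) \<partial>(U_law (d - 1) f \<Otimes>\<^sub>M law d)) = (\<integral>u. ?g u \<partial>U_law (d - 1) f) * (\<integral>e. ?k e \<partial>law d)"
    by (rule integral_prod_pair) (auto intro: prob_space_U_law f prob_space_law simp del: of_real_sum One_nat_def)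
  also have "(\<integral>u. ?g u \<partial>U_law (d - 1) f) = cf (U_law (d - 1) f) (\<lambda>j u. R * sph d u j) d (\<lambda>j. of_real (t j))"
    by (simp add: cf_def)
  also have "iexp (\<Sum>j<d. t j * C j) = (\<Prod>j<d. iexp (t j * C j))"
    by (rule iexp_sum)
  finally show ?thesis
    by (simp only: Fourier_law prod.distrib) (simp only: mult_ac)
qed

lemma model_component_measurable:
  assumes j: "j < d"
  shows "(\<lambda>z. C j + R * sph d (fst z) j + snd z j) \<in> borel_measurable (U_law (d - 1) f \<Otimes>\<^sub>M law d)"
proof -
  have [measurable]: "(\<lambda>u. sph d u j) \<in> borel_measurable (U_law (d - 1) f)" "(\<lambda>e. e j) \<in> borel_measurable (law d)"
    using sph_measurable[OF j] j by (auto cong: measurable_cong_sets)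
  show ?thesis by measurable
qed

lemma model_law_eq:
  "model_law d C R f (law d) = distr (U_law (d - 1) f \<Otimes>\<^sub>M law d) (Rd d)
     (\<lambda>z. \<lambda>j\<in>{..<d}. C j + R * sph d (fst z) j + snd z j)"
  unfolding model_law_def case_prod_unfold ..

lemma Fourier_model_law:
  assumes f: "is_density (d - 1) f" and R: "R \<ge> 0"
  shows "(\<integral>y. iexp (\<Sum>j<d. t j * y j) \<partial>model_law d C R f (law d))
    = cf (U_law (d - 1) f) (\<lambda>j u. R * sph d u j) d (\<lambda>j. of_real (t j)) *
      (\<Prod>j<d. iexp (t j * C j) * char (Q j) (t j))"
proof -
  have [measurable]: "(\<lambda>y. \<Sum>j<d. t j * y j) \<in> borel_measurable (Rd d)"
    unfolding Rd_def
    by (intro borel_measurable_sum borel_measurable_times measurable_component_singleton) auto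
  have "(\<lambda>z. \<lambda>j\<in>{..<d}. C j + R * sph d (fst z) j + snd z j) \<in> U_law (d - 1) f \<Otimes>\<^sub>M law d \<rightarrow>\<^sub>M Rd d"
    unfolding Rd_def by (rule measurable_restrict, rule model_component_measurable) simp
  then have "(\<integral>y. iexp (\<Sum>j<d. t j * y j) \<partial>model_law d C R f (law d))
      = (\<integral>z. iexp (\<Sum>j<d. t j * (\<lambda>j\<in>{..<d}. C j + R * sph d (fst z) j + snd z j) j) \<partial>(U_law (d - 1) f \<Otimes>\<^sub>M law d))"
    unfolding model_law_eq by (rule integral_distr) measurable
  also have "\<dots> = (\<integral>z. iexp (\<Sum>j<d. t j * (C j + R * sph d (fst z) j + snd z j)) \<partial>(U_law (d - 1) f \<Otimes>\<^sub>M law d))"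
    by (intro Bochner_Integration.integral_cong refl arg_cong[where f = iexp] sum.cong) simp
  finally show ?thesis
    unfolding Fourier_model[OF f R] .
qed

lemma shift_measurable: "(\<lambda>x. \<lambda>j\<in>{..<d}. x j - m j) \<in> law d \<rightarrow>\<^sub>M Rd d"
  unfolding Rd_def by (rule measurable_restrict) (auto intro!: borel_measurable_diff)

lemma Fourier_shift:
  "(\<integral>x. iexp (\<Sum>j<d. t j * (x j - m j)) \<partial>law d) = (\<Prod>j<d. iexp (- (t j * m j)) * char (Q j) (t j))"
proof -
  have "(\<Sum>j<d. t j * (x j - m j)) = (\<Sum>j<d. - (t j * m j)) + (\<Sum>j<d. t j * x j)" for x :: "nat \<Rightarrow> real"
    by (simp add: right_diff_distrib sum_subtractf sum_negf)
  then have "iexp (\<Sum>j<d. t j * (x j - m j)) = iexp (\<Sum>j<d. - (t j * m j)) * iexp (\<Sum>j<d. t j * x j)" for x :: "nat \<Rightarrow> real"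
    by (simp only: of_real_add distrib_left exp_add)
  then show ?thesis
    by (simp only: integral_mult_right_zero Fourier_law) (simp only: iexp_sum prod.distrib)
qed

end

lemma law_eq_shift_iff:
  assumes "noise Q" and "noise Qs"
  shows "(\<Pi>\<^sub>M j\<in>{..<d}. Q j) = shift_measure d m (\<Pi>\<^sub>M j\<in>{..<d}. Qs j) \<longleftrightarrow>
    (\<forall>t. (\<Prod>j<d. char (Q j) (t j)) = (\<Prod>j<d. iexp (- (t j * m j)) * char (Qs j) (t j)))"
proof -
  interpret Q: noise Q by fact
  interpret Qs: noise Qs by fact
  show ?thesis
  proof
    assume eq: "Q.law d = shift_measure d m (Qs.law d)"
    show "\<forall>t. (\<Prod>j<d. char (Q j) (t j)) = (\<Prod>j<d. iexp (- (t j * m j)) * char (Qs j) (t j))"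
    proof
      fix t :: "nat \<Rightarrow> real"
      have [measurable]: "(\<lambda>y. \<Sum>j<d. t j * y j) \<in> borel_measurable (Rd d)"
        unfolding Rd_def
        by (intro borel_measurable_sum borel_measurable_times measurable_component_singleton) auto
      have "(\<Prod>j<d. char (Q j) (t j)) = (\<integral>x. iexp (\<Sum>j<d. t j * x j) \<partial>shift_measure d m (Qs.law d))"
        unfolding eq[symmetric] by (rule Q.Fourier_law[symmetric])
      also have "\<dots> = (\<integral>x. iexp (\<Sum>j<d. t j * (\<lambda>j\<in>{..<d}. x j - m j) j) \<partial>Qs.law d)"
        unfolding shift_measure_def by (rule integral_distr[OF Qs.shift_measurable]) measurable
      also have "\<dots> = (\<integral>x. iexp (\<Sum>j<d. t j * (x j - m j)) \<partial>Qs.law d)"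
        by (intro Bochner_Integration.integral_cong refl arg_cong[where f = iexp] sum.cong) simp
      finally show "(\<Prod>j<d. char (Q j) (t j)) = (\<Prod>j<d. iexp (- (t j * m j)) * char (Qs j) (t j))"
        unfolding Qs.Fourier_shift .
    qed
  next
    assume eq: "\<forall>t. (\<Prod>j<d. char (Q j) (t j)) = (\<Prod>j<d. iexp (- (t j * m j)) * char (Qs j) (t j))"
    have "distr (Q.law d) (Rd d) (\<lambda>x. \<lambda>j\<in>{..<d}. x j) = distr (Qs.law d) (Rd d) (\<lambda>x. \<lambda>j\<in>{..<d}. x j - m j)"
    proof (rule distr_eqI_Fourier)
      show "(\<integral>x. iexp (\<Sum>j<d. t j * x j) \<partial>Q.law d) = (\<integral>x. iexp (\<Sum>j<d. t j * (x j - m j)) \<partial>Qs.law d)" for t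
        unfolding Q.Fourier_law Qs.Fourier_shift using eq by blast
    qed (auto intro: Q.prob_space_law Qs.prob_space_law)
    moreover have "distr (Q.law d) (Rd d) (\<lambda>x. \<lambda>j\<in>{..<d}. x j) = distr (Q.law d) (Rd d) (\<lambda>x. x)"
      by (rule distr_cong) (auto simp: space_PiM PiE_def extensional_restrict)
    moreover have "distr (Q.law d) (Rd d) (\<lambda>x. x) = Q.law d"
      by (rule distr_id2) (simp add: Q.sets_law)
    ultimately show "Q.law d = shift_measure d m (Qs.law d)"
      by (simp add: shift_measure_def)
  qed
qed

section \<open>Recovery of the radius, the density and the noise\<close>

lemma AE_distr_eq_transfer:
  assumes "distr P N X = distr P' N Y" and [measurable]: "X \<in> P \<rightarrow>\<^sub>M N" "Y \<in> P' \<rightarrow>\<^sub>M N" "Measurable.pred N S"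
    and "AE y in P'. S (Y y)"
  shows "AE x in P. S (X x)"
proof -
  have S: "{y \<in> space N. S y} \<in> sets N"
    by measurable
  have "AE y in distr P' N Y. S y"
    using assms(5) S by (subst AE_distr_iff) auto
  then have "AE y in distr P N X. S y"
    by (simp only: assms(1))
  then show ?thesis
    using S by (subst (asm) AE_distr_iff) auto
qed

text \<open>The translated signal has the law of the other one, so its squared norm is almost surely
  \<open>Rs\<^sup>2\<close>. Expanding the square leaves a linear form in the point of the sphere,
  which for nonzero \<open>m\<close> takes any given value with probability 0.\<close>

lemma shift_between_spheres_trivial:
  assumes d: "d \<ge> 2" and f: "is_density (d - 1) f" and fs: "is_density (d - 1) fs"
    and R: "R \<ge> 0" and Rs: "Rs > 0"
    and shift: "\<And>t. cf (U_law (d - 1) fs) (\<lambda>j u. Rs * sph d u j) d t =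
        exp (\<i> * (\<Sum>j<d. t j * of_real (m j))) * cf (U_law (d - 1) f) (\<lambda>j u. R * sph d u j) d t"
  shows "R = Rs" and "j < d \<Longrightarrow> m j = 0"
proof -
  let ?P = "U_law (d - 1) f" and ?P' = "U_law (d - 1) fs"
  let ?X = "\<lambda>j u. R * sph d u j + m j" and ?Y = "\<lambda>j u. Rs * sph d u j"
  interpret P: prob_space ?P by (rule prob_space_U_law[OF f])
  interpret P': prob_space ?P' by (rule prob_space_U_law[OF fs])
  have X: "?X j \<in> borel_measurable ?P" and Y: "?Y j \<in> borel_measurable ?P'" if "j < d" for j
    using sph_measurable[OF that] by (simp_all cong: measurable_cong_sets)
  let ?Xr = "\<lambda>u. \<lambda>j\<in>{..<d}. ?X j u" and ?Yr = "\<lambda>u. \<lambda>j\<in>{..<d}. ?Y j u"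
  have Xr: "?Xr \<in> ?P \<rightarrow>\<^sub>M Rd d" and Yr: "?Yr \<in> ?P' \<rightarrow>\<^sub>M Rd d"
    unfolding Rd_def by (rule measurable_restrict, rule X, simp, rule measurable_restrict, rule Y, simp)
  have eq: "distr ?P (Rd d) ?Xr = distr ?P' (Rd d) ?Yr"
  proof (rule distr_eqI_Fourier[OF P.prob_space_axioms P'.prob_space_axioms X Y])
    fix t :: "nat \<Rightarrow> real"
    have "(\<integral>u. iexp (\<Sum>j<d. t j * ?X j u) \<partial>?P)
        = (\<integral>u. exp (\<i> * (\<Sum>j<d. of_real (t j) * of_real (m j))) * exp (\<i> * (\<Sum>j<d. of_real (t j) * of_real (R * sph d u j))) \<partial>?P)"
      by (intro Bochner_Integration.integral_cong refl)
         (simp add: exp_add[symmetric] distrib_left sum.distrib add.commute)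
    also have "\<dots> = cf ?P' ?Y d (\<lambda>j. of_real (t j))"
      unfolding shift by (simp add: cf_def)
    finally show "(\<integral>u. iexp (\<Sum>j<d. t j * ?X j u) \<partial>?P) = (\<integral>u. iexp (\<Sum>j<d. t j * ?Y j u) \<partial>?P')"
      by (simp add: cf_def)
  qed
  have comp: "(\<lambda>y. y l) \<in> borel_measurable (Rd d)" if "l < d" for l
    unfolding Rd_def using that by (intro measurable_component_singleton) simp
  \<comment> \<open>With \<open>R = 0\<close> the translated signal would be constant, whereas the
    coordinates of the other one have no atoms because \<open>Rs > 0\<close>.\<close>
  have R0: "R \<noteq> 0"
  proof
    assume R0: "R = 0"
    have [measurable]: "(\<lambda>y. y 0) \<in> borel_measurable (Rd d)"
      using d by (intro comp) simp
    have "AE u in ?P'. ?Yr u 0 = m 0"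
    proof (rule AE_distr_eq_transfer[OF eq[symmetric] Yr Xr])
      show "Measurable.pred (Rd d) (\<lambda>y. y 0 = m 0)"
        by measurable
    qed (use d R0 in simp)
    moreover have "AE u in ?P'. sph d u 0 \<noteq> m 0 / Rs"
      using d by (intro AE_U_law[OF fs] AE_sph_neq) auto
    ultimately have "AE u in ?P'. False"
      by eventually_elim (use d Rs in \<open>auto simp: field_simps\<close>)
    then show False by simp
  qed
  have [measurable]: "(\<lambda>y. \<Sum>j<d. (y j)\<^sup>2) \<in> borel_measurable (Rd d)"
    by (intro borel_measurable_sum borel_measurable_power comp) auto
  have norm: "(\<Sum>j<d. (r * sph d u j)\<^sup>2) = r\<^sup>2" for r u
    using sum_sph_power2[of d u] d by (simp add: power_mult_distrib sum_distrib_left[symmetric])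
  have "AE u in ?P. (\<Sum>j<d. (?Xr u j)\<^sup>2) = Rs\<^sup>2"
  proof (rule AE_distr_eq_transfer[OF eq Xr Yr])
    show "Measurable.pred (Rd d) (\<lambda>y. (\<Sum>j<d. (y j)\<^sup>2) = Rs\<^sup>2)"
      by measurable
    show "AE u in ?P'. (\<Sum>j<d. (?Yr u j)\<^sup>2) = Rs\<^sup>2"
      using norm[of Rs] by simp
  qed
  moreover have "(\<Sum>j<d. (?Xr u j)\<^sup>2) = R\<^sup>2 + 2 * R * (\<Sum>j<d. m j * sph d u j) + (\<Sum>j<d. (m j)\<^sup>2)" for u
  proof -
    have "(\<Sum>j<d. (?Xr u j)\<^sup>2) = (\<Sum>j<d. (R * sph d u j)\<^sup>2 + 2 * R * (m j * sph d u j) + (m j)\<^sup>2)"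
      by (intro sum.cong refl) (simp add: power2_sum algebra_simps)
    then show ?thesis
      unfolding norm[symmetric, of R u] by (simp add: sum.distrib sum_distrib_left)
  qed
  ultimately have AE: "AE u in ?P. R\<^sup>2 + 2 * R * (\<Sum>j<d. m j * sph d u j) + (\<Sum>j<d. (m j)\<^sup>2) = Rs\<^sup>2"
    by simp
  show m0: "m j = 0" if "j < d" for j
  proof (rule ccontr)
    assume "m j \<noteq> 0"
    with that have "\<exists>j<d. m j \<noteq> 0" by blast
    then have "AE u in ?P. (\<Sum>j<d. m j * sph d u j) \<noteq> (Rs\<^sup>2 - R\<^sup>2 - (\<Sum>j<d. (m j)\<^sup>2)) / (2 * R)"
      by (intro AE_U_law[OF f] AE_sph_linear_form_neq[OF d])
    with AE have "AE u in ?P. False"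
      by eventually_elim (use R0 in \<open>auto simp: field_simps\<close>)
    then show False by simp
  qed
  from AE have "AE u in ?P. R\<^sup>2 = Rs\<^sup>2"
    by (simp add: m0)
  then have "R\<^sup>2 = Rs\<^sup>2"
    by simp
  then show "R = Rs"
    using R Rs by (simp add: power2_eq_iff_nonneg)
qed

text \<open>The difference \<open>H\<close> of the densities is tested against its own sign, written
  through \<open>sph_inv\<close> as a bounded function on the sphere; this yields the integral of
  \<open>|H|\<close>. Positivity of \<open>R\<close> lets the frequencies be rescaled to the unit
  sphere.\<close>

lemma density_unique_of_cf:
  assumes d: "d \<ge> 2" and f: "is_density (d - 1) f" and fs: "is_density (d - 1) fs" and R: "R > 0"
    and eq: "\<And>t. cf (U_law (d - 1) fs) (\<lambda>j u. R * sph d u j) d t = cf (U_law (d - 1) f) (\<lambda>j u. R * sph d u j) d t"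
  shows "AE u in lebn (d - 1). u \<in> cube (d - 1) 0 1 \<longrightarrow> f u = fs u"
proof -
  define n where "n = d - 1"
  note f = f[folded n_def] and fs = fs[folded n_def] and eq = eq[folded n_def]
  let ?I = "indicator (cube n 0 1) :: (nat \<Rightarrow> real) \<Rightarrow> real"
  define H where "H u = f u * ?I u - fs u * ?I u" for u
  have dens: "integrable (lebn n) (\<lambda>u. g u * ?I u)" if "is_density n g" for g
    using that by (intro integrableI_nonneg) (auto simp: is_density_def indicator_def)
  have Hint: "integrable (lebn n) H"
    unfolding H_def using dens[OF f] dens[OF fs] by simp
  have Hm [measurable]: "H \<in> borel_measurable (lebn n)"
    using Hint by auto
  have S: "(\<lambda>u. sph d u j) \<in> borel_measurable (lebn n)" if "j < d" for j
    using sph_measurable[OF that] by (simp add: n_def)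
  have zero: "(\<integral>u. of_real (H u) * iexp (\<Sum>j<d. t j * sph d u j) \<partial>lebn n) = 0" for t
  proof -
    let ?e = "\<lambda>u. iexp (\<Sum>j<d. t j * sph d u j)"
    have "(\<lambda>u. \<Sum>j<d. t j * sph d u j) \<in> borel_measurable (lebn n)"
      by (intro borel_measurable_sum borel_measurable_times S) auto
    then have e [measurable]: "?e \<in> borel_measurable (lebn n)"
      by measurable
    have U: "(\<integral>u. of_real (g u * ?I u) * ?e u \<partial>lebn n) = cf (U_law n g) (\<lambda>j u. R * sph d u j) d (\<lambda>j. of_real (t j / R))"
      if g: "is_density n g" for g
      unfolding integral_U_law[OF g e, symmetric] cf_def using R by simp
    have int: "integrable (lebn n) (\<lambda>u. of_real (g u * ?I u) * ?e u)" if g: "is_density n g" for g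
      by (rule Bochner_Integration.integrable_bound[OF dens[OF g]])
         (use density_measurable[OF g] in \<open>auto simp: norm_mult simp del: of_real_mult of_real_sum\<close>)
    have "(\<integral>u. of_real (H u) * ?e u \<partial>lebn n)
        = (\<integral>u. of_real (f u * ?I u) * ?e u - of_real (fs u * ?I u) * ?e u \<partial>lebn n)"
      unfolding H_def of_real_diff left_diff_distrib ..
    also have "\<dots> = 0"
      unfolding Bochner_Integration.integral_diff[OF int[OF f] int[OF fs]] U[OF f] U[OF fs] eq by simp
    finally show ?thesis .
  qed
  define G where "G y = complex_of_real (sgn (H (sph_inv d y)))" for y
  have G: "G \<in> borel_measurable (Rd d)"
    unfolding G_def using sph_inv_measurable[OF d, folded n_def] by measurable
  have Gb: "norm (G y) \<le> 1" for y
    by (simp add: G_def sgn_if)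
  have rs: "(\<lambda>j\<in>{..<d}. sph d u j) = sph d u" for u
    by (simp add: sph_def restrict_def fun_eq_iff)
  have Hc: "integrable (lebn n) (\<lambda>u. complex_of_real (H u))"
    using Hint by simp
  have "(\<integral>u. of_real (H u) * G (sph d u) \<partial>lebn n) = 0"
    using Fourier_zero[OF Hc S zero G Gb] unfolding rs by simp
  also have "(\<integral>u. of_real (H u) * G (sph d u) \<partial>lebn n) = (\<integral>u. complex_of_real \<bar>H u\<bar> \<partial>lebn n)"
  proof (rule integral_cong_AE)
    have "(\<lambda>u. sph d u) \<in> lebn n \<rightarrow>\<^sub>M Rd d"
      using measurable_restrict[of "{..<d}" "\<lambda>j u. sph d u j" "lebn n" "\<lambda>_. borel"] S unfolding rs Rd_def by simp
    then show "(\<lambda>u. of_real (H u) * G (sph d u)) \<in> borel_measurable (lebn n)"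
      using G by measurable
    show "(\<lambda>u. complex_of_real \<bar>H u\<bar>) \<in> borel_measurable (lebn n)"
      by measurable
    show "AE u in lebn n. of_real (H u) * G (sph d u) = complex_of_real \<bar>H u\<bar>"
      using AE_sin_sph_angle_nonzero[of n]
    proof eventually_elim
      case (elim u)
      show ?case
      proof (cases "u \<in> cube n 0 1")
        case True
        then have "sph_inv d (sph d u) = u"
          using elim d by (intro sph_inv_sph) (auto simp: n_def)
        then show ?thesis
          unfolding G_def by (simp only: of_real_mult[symmetric] abs_sgn)
      next
        case False
        then show ?thesis by (simp add: H_def)
      qed
    qed
  qed
  finally have "(\<integral>u. \<bar>H u\<bar> \<partial>lebn n) = 0"
    by simp
  then have "AE u in lebn n. \<bar>H u\<bar> = 0"
    using Hint by (subst (asm) integral_nonneg_eq_0_iff_AE) auto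
  then show ?thesis
    unfolding n_def[symmetric] by eventually_elim (auto simp: H_def)
qed

text \<open>The zeros of the marginal are isolated, so it cancels at all points near
  \<open>s\<close> except perhaps \<open>s\<close> itself, where continuity decides.\<close>

lemma noise_factors_eq:
  assumes S: "bounded_signal P X d B" and j: "j < d"
    and c: "\<And>s. isCont \<psi> s" "\<And>s. isCont \<psi>' s"
    and eq: "\<And>s. marginal_cf P X d j (of_real s) * \<psi> s = marginal_cf P X d j (of_real s) * \<psi>' s"
  shows "\<psi> s = (\<psi>' s :: complex)"
proof -
  interpret bounded_signal P X d B by fact
  have "\<forall>\<^sub>F z in at (complex_of_real s). marginal_cf P X d j z \<noteq> 0"
    by (rule entire_eventually_nonzero[OF marginal_cf_holomorphic, of _ 0]) simp
  then obtain e where e: "e > 0"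
      "\<And>z. z \<noteq> complex_of_real s \<Longrightarrow> dist z (complex_of_real s) < e \<Longrightarrow> marginal_cf P X d j z \<noteq> 0"
    by (auto simp: eventually_at)
  have "marginal_cf P X d j (of_real x) \<noteq> 0" if "x \<noteq> s" "dist x s < e" for x
    using that by (intro e(2)) (auto simp: dist_of_real)
  then have "\<forall>\<^sub>F x in at s. \<psi> x = \<psi>' x"
    using eq e(1) unfolding eventually_at by (intro exI[of _ e]) auto
  then have "(\<psi> \<longlongrightarrow> \<psi>' s) (at s)"
    using c(2)[of s] by (simp add: isCont_def tendsto_cong)
  moreover have "(\<psi> \<longlongrightarrow> \<psi> s) (at s)"
    using c(1)[of s] by (simp add: isCont_def)
  ultimately show ?thesis
    using tendsto_unique by (metis at_neq_bot)
qed

lemma model_law_eq_iff: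
  assumes "noise Q" and "noise Qs" and d: "d \<ge> 2"
    and f: "is_density (d - 1) f" and fs: "is_density (d - 1) fs" and R: "R \<ge> 0" and Rs: "Rs > 0"
  shows "model_law d C R f (\<Pi>\<^sub>M j\<in>{..<d}. Q j) = model_law d Cs Rs fs (\<Pi>\<^sub>M j\<in>{..<d}. Qs j)
    \<longleftrightarrow> R = Rs \<and> (AE u in lebn (d - 1). u \<in> cube (d - 1) 0 1 \<longrightarrow> f u = fs u)
       \<and> (\<exists>m. (\<forall>j<d. C j = Cs j + m j) \<and> (\<Pi>\<^sub>M j\<in>{..<d}. Q j) = shift_measure d m (\<Pi>\<^sub>M j\<in>{..<d}. Qs j))"
    (is "?L \<longleftrightarrow> _ \<and> ?AE \<and> ?shift")
proof -
  interpret Q: noise Q by fact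
  interpret Qs: noise Qs by fact
  let ?P = "U_law (d - 1) f" and ?P' = "U_law (d - 1) fs"
  let ?X = "\<lambda>j u. R * sph d u j" and ?Y = "\<lambda>j u. Rs * sph d u j"
  have Rs0: "Rs \<ge> 0"
    using Rs by simp
  show ?thesis
  proof (intro iffI conjI; (elim conjE)?)
    assume L: ?L
    \<comment> \<open>Centre and noise are merged: these are the characteristic functions of the
      coordinates of the noise translated by the centre.\<close>
    define \<psi> where "\<psi> j s = iexp (s * C j) * char (Q j) s" for j s
    define \<psi>' where "\<psi>' j s = iexp (s * Cs j) * char (Qs j) s" for j s
    have cont: "isCont (\<psi> j) s" "isCont (\<psi>' j) s" for j s
      unfolding \<psi>_def \<psi>'_def by (intro continuous_intros Q.Q.isCont_char Qs.Q.isCont_char)+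
    have init: "\<psi> j 0 = 1" "\<psi>' j 0 = 1" for j
      by (simp_all add: \<psi>_def \<psi>'_def Q.Q.char_zero Qs.Q.char_zero)
    have main: "cf ?P ?X d (\<lambda>j. of_real (t j)) * (\<Prod>j<d. \<psi> j (t j))
        = cf ?P' ?Y d (\<lambda>j. of_real (t j)) * (\<Prod>j<d. \<psi>' j (t j))" for t
      unfolding \<psi>_def \<psi>'_def Q.Fourier_model_law[OF f R, symmetric]
        Qs.Fourier_model_law[OF fs Rs0, symmetric] L ..
    have S: "bounded_signal ?P ?X d R" and T: "bounded_signal ?P' ?Y d Rs"
      using bounded_signal_sph f fs R Rs0 by blast+
    obtain m :: "nat \<Rightarrow> real" where
      m: "\<And>t. cf ?P' ?Y d t = exp (\<i> * (\<Sum>j<d. t j * of_real (m j))) * cf ?P ?X d t"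
      using cf_eq_up_to_shift[OF S T init(1,2) cont(2) main
          sph_cf_nondegenerate[OF d f R] sph_cf_nondegenerate[OF d fs Rs0]] by blast
    show RR: "R = Rs"
      by (rule shift_between_spheres_trivial(1)[OF d f fs R Rs m])
    have m0: "m j = 0" if "j < d" for j
      by (rule shift_between_spheres_trivial(2)[OF d f fs R Rs m that])
    have cfeq: "cf ?P' ?X d t = cf ?P ?X d t" for t
      using m[of t] m0 RR by simp
    show ?AE
      by (rule density_unique_of_cf[OF d f fs _ cfeq]) (use RR Rs in simp)
    have \<psi>: "\<psi> j s = \<psi>' j s" if j: "j < d" for j s
    proof (rule noise_factors_eq[OF S j cont])
      fix s
      have e: "(\<lambda>l. complex_of_real (((\<lambda>_. 0)(j := s)) l)) = (\<lambda>_. 0)(j := of_real s)"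
        by auto
      have p: "(\<Prod>l<d. g l (((\<lambda>_. 0)(j := s)) l)) = g j s" if "\<And>l. g l 0 = 1" for g :: "nat \<Rightarrow> real \<Rightarrow> complex"
        using j that by (subst prod.remove[of _ j]) auto
      show "marginal_cf ?P ?X d j (of_real s) * \<psi> j s = marginal_cf ?P ?X d j (of_real s) * \<psi>' j s"
        using main[of "(\<lambda>_. 0)(j := s)"] unfolding e p[of \<psi>, OF init(1)] p[of \<psi>', OF init(2)] marginal_cf_def
        using cfeq RR by simp
    qed
    show ?shift
    \<comment> \<open>The witness is the difference of the centres. It is distinct from the shift
      \<open>m\<close> between the two signals, which has just been shown to vanish.\<close>
    proof (intro exI[of _ "\<lambda>j. C j - Cs j"] conjI allI impI)
      have "char (Q j) s = iexp (- (s * (C j - Cs j))) * char (Qs j) s" if "j < d" for j s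
      proof -
        have "char (Q j) s = iexp (- (s * C j)) * \<psi> j s"
          by (simp add: \<psi>_def mult.assoc[symmetric] exp_add[symmetric])
        also have "\<dots> = (iexp (- (s * C j)) * iexp (s * Cs j)) * char (Qs j) s"
          unfolding \<psi>[OF that] \<psi>'_def by simp
        also have "iexp (- (s * C j)) * iexp (s * Cs j) = iexp (- (s * (C j - Cs j)))"
          by (simp add: exp_add[symmetric] algebra_simps)
        finally show ?thesis .
      qed
      then show "Q.law d = shift_measure d (\<lambda>j. C j - Cs j) (Qs.law d)"
        unfolding law_eq_shift_iff[OF assms(1,2)] by (intro allI prod.cong refl) simp
    qed simp
  next
    assume RR: "R = Rs" and AE: ?AE and ?shift
    then obtain m where C: "\<And>j. j < d \<Longrightarrow> C j = Cs j + m j"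
      and sh: "Q.law d = shift_measure d m (Qs.law d)"
      by auto
    note chars = sh[unfolded law_eq_shift_iff[OF assms(1,2)], rule_format]
    have U: "?P = ?P'"
      unfolding U_law_def
    proof (rule density_cong)
      show "AE u in lebn (d - 1). ennreal (f u * indicator (cube (d - 1) 0 1) u) = ennreal (fs u * indicator (cube (d - 1) 0 1) u)"
        using AE by eventually_elim (auto simp: indicator_def)
    qed (use density_measurable[OF f] density_measurable[OF fs] in measurable)
    interpret PQ: pair_prob_space ?P "Q.law d"
      by (intro pair_prob_space.intro pair_sigma_finite.intro prob_space_imp_sigma_finite
          prob_space_U_law[OF f] Q.prob_space_law)
    interpret PQs: pair_prob_space ?P' "Qs.law d"
      by (intro pair_prob_space.intro pair_sigma_finite.intro prob_space_imp_sigma_finite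
          prob_space_U_law[OF fs] Qs.prob_space_law)
    show ?L
      unfolding Q.model_law_eq Qs.model_law_eq
    proof (rule distr_eqI_Fourier[OF PQ.prob_space_axioms PQs.prob_space_axioms
            Q.model_component_measurable Qs.model_component_measurable])
      fix t :: "nat \<Rightarrow> real"
      have "(\<Prod>j<d. iexp (t j * C j) * char (Q j) (t j)) = (\<Prod>j<d. iexp (t j * C j)) * (\<Prod>j<d. iexp (- (t j * m j)) * char (Qs j) (t j))"
        by (simp only: prod.distrib chars)
      also have "\<dots> = (\<Prod>j<d. iexp (t j * Cs j) * char (Qs j) (t j))"
        unfolding prod.distrib[symmetric]
        by (intro prod.cong refl) (simp add: C distrib_left exp_add exp_minus)
      finally show "(\<integral>z. iexp (\<Sum>j<d. t j * (C j + R * sph d (fst z) j + snd z j)) \<partial>(?P \<Otimes>\<^sub>M Q.law d))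
          = (\<integral>z. iexp (\<Sum>j<d. t j * (Cs j + Rs * sph d (fst z) j + snd z j)) \<partial>(?P' \<Otimes>\<^sub>M Qs.law d))"
        unfolding Q.Fourier_model[OF f R] Qs.Fourier_model[OF fs Rs0] by (simp only: U RR)
    qed
  qed
qed

lemma centered_shift_eq_0:
  assumes "noise Q" and "noise Qs"
    and sh: "(\<Pi>\<^sub>M j\<in>{..<d}. Q j) = shift_measure d m (\<Pi>\<^sub>M j\<in>{..<d}. Qs j)" and j: "j < d"
    and Q0: "(\<integral>x. x j \<partial>(\<Pi>\<^sub>M j\<in>{..<d}. Q j)) = 0"
    and Qs0: "integrable (\<Pi>\<^sub>M j\<in>{..<d}. Qs j) (\<lambda>x. x j)" "(\<integral>x. x j \<partial>(\<Pi>\<^sub>M j\<in>{..<d}. Qs j)) = 0"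
  shows "m j = 0"
proof -
  interpret Q: noise Q by fact
  interpret Qs: noise Qs by fact
  interpret prob_space "Qs.law d"
    by (rule Qs.prob_space_law)
  have "(\<lambda>x. x j) \<in> borel_measurable (Rd d)"
    unfolding Rd_def using j by (intro measurable_component_singleton) simp
  then have "0 = (\<integral>x. (\<lambda>j\<in>{..<d}. x j - m j) j \<partial>Qs.law d)"
    using integral_distr[OF Qs.shift_measurable, of "\<lambda>x. x j" d m] Q0 unfolding sh shift_measure_def by simp
  also have "\<dots> = (\<integral>x. x j - m j \<partial>Qs.law d)"
    using j by simp
  also have "\<dots> = - m j"
    using Qs0 by (simp add: prob_space)
  finally show ?thesis by simp
qed

lemma shift_measure_0:
  assumes "noise Qs" and "\<And>j. j < d \<Longrightarrow> m j = 0"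
  shows "shift_measure d m (\<Pi>\<^sub>M j\<in>{..<d}. Qs j) = (\<Pi>\<^sub>M j\<in>{..<d}. Qs j)"
proof -
  interpret Qs: noise Qs by fact
  have "shift_measure d m (Qs.law d) = distr (Qs.law d) (Rd d) (\<lambda>x. x)"
    unfolding shift_measure_def
    by (rule distr_cong) (auto simp: space_PiM PiE_def extensional_def assms(2))
  also have "\<dots> = Qs.law d"
    by (rule distr_id2) (simp add: Qs.sets_law)
  finally show ?thesis .
qed

text \<open>A law determines its density only almost everywhere, hence the form of
  \<open>f = fs\<close>. The radius \<open>Rs\<close> is positive because for \<open>Rs = 0\<close>
  the observation would not depend on \<open>fs\<close>.\<close>

theorem theorem2p3:
  fixes d :: nat and Cs C :: "nat \<Rightarrow> real" and Rs R :: real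
    and fs f :: "(nat \<Rightarrow> real) \<Rightarrow> real" and Qs Q :: "nat \<Rightarrow> real measure"
  assumes d2: "d \<ge> 2"
    and Rs_pos: "Rs > 0"
    and Qs_prob: "\<forall>j<d. prob_space (Qs j) \<and> sets (Qs j) = sets borel"
    and fs_dens: "is_density (d - 1) fs"
    and H2: "d > 2 \<longrightarrow> (\<exists>\<gamma>>0. \<forall>u \<in> (\<Pi>\<^sub>E i\<in>{..<d - 1}. {0<..<\<gamma>}). fs u > 0)"
    and Q_prob: "\<forall>j<d. prob_space (Q j) \<and> sets (Q j) = sets borel"
    and f_dens: "is_density (d - 1) f"
    and R_nonneg: "R \<ge> 0"
  shows "(model_law d C R f (\<Pi>\<^sub>M j\<in>{..<d}. Q j) = model_law d Cs Rs fs (\<Pi>\<^sub>M j\<in>{..<d}. Qs j)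
           \<longleftrightarrow> R = Rs
             \<and> (AE u in lebn (d - 1). u \<in> cube (d - 1) 0 1 \<longrightarrow> f u = fs u)
             \<and> (\<exists>m :: nat \<Rightarrow> real. (\<forall>j<d. C j = Cs j + m j)
                  \<and> (\<Pi>\<^sub>M j\<in>{..<d}. Q j) = shift_measure d m (\<Pi>\<^sub>M j\<in>{..<d}. Qs j)))
       \<and> ((model_law d C R f (\<Pi>\<^sub>M j\<in>{..<d}. Q j) = model_law d Cs Rs fs (\<Pi>\<^sub>M j\<in>{..<d}. Qs j)
            \<and> (\<forall>j<d. integrable (\<Pi>\<^sub>M j\<in>{..<d}. Q j) (\<lambda>x. x j)
                     \<and> (\<integral>x. x j \<partial>(\<Pi>\<^sub>M j\<in>{..<d}. Q j)) = 0)
            \<and> (\<forall>j<d. integrable (\<Pi>\<^sub>M j\<in>{..<d}. Qs j) (\<lambda>x. x j)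
                     \<and> (\<integral>x. x j \<partial>(\<Pi>\<^sub>M j\<in>{..<d}. Qs j)) = 0))
          \<longrightarrow> (\<forall>j<d. C j = Cs j) \<and> (\<Pi>\<^sub>M j\<in>{..<d}. Q j) = (\<Pi>\<^sub>M j\<in>{..<d}. Qs j))"
proof -
  \<comment> \<open>Indices from \<open>d\<close> on are filled with the point mass at 0 to obtain a
    family indexed by all naturals, as \<open>noise\<close> demands; the product over
    \<open>{..<d}\<close> is unchanged.\<close>
  define ext :: "(nat \<Rightarrow> real measure) \<Rightarrow> nat \<Rightarrow> real measure"
    where "ext K j = (if j < d then K j else return borel 0)" for K j
  have noise: "noise (ext K)" if "\<forall>j<d. prob_space (K j) \<and> sets (K j) = sets borel" for K
  proof (rule noise.intro)
    fix j
    show "real_distribution (ext K j)"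
      using that
      by (auto simp: ext_def real_distribution_def real_distribution_axioms_def intro!: prob_space_return)
  qed
  have PiM_ext: "(\<Pi>\<^sub>M j\<in>{..<d}. K j) = (\<Pi>\<^sub>M j\<in>{..<d}. ext K j)" for K
    by (rule PiM_cong) (auto simp: ext_def)
  note nQ = noise[OF Q_prob] and nQs = noise[OF Qs_prob]
  note iff = model_law_eq_iff[OF nQ nQs d2 f_dens fs_dens R_nonneg Rs_pos, of C Cs]
  show ?thesis
    unfolding PiM_ext[of Q] PiM_ext[of Qs]
  proof (intro conjI[OF iff] impI; elim conjE)
    assume "model_law d C R f (\<Pi>\<^sub>M j\<in>{..<d}. ext Q j) = model_law d Cs Rs fs (\<Pi>\<^sub>M j\<in>{..<d}. ext Qs j)"
    then obtain m where m: "\<And>j. j < d \<Longrightarrow> C j = Cs j + m j"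
      and sh: "(\<Pi>\<^sub>M j\<in>{..<d}. ext Q j) = shift_measure d m (\<Pi>\<^sub>M j\<in>{..<d}. ext Qs j)"
      unfolding iff by auto
    assume cent: "\<forall>j<d. integrable (\<Pi>\<^sub>M j\<in>{..<d}. ext Q j) (\<lambda>x. x j) \<and> (\<integral>x. x j \<partial>(\<Pi>\<^sub>M j\<in>{..<d}. ext Q j)) = 0"
      "\<forall>j<d. integrable (\<Pi>\<^sub>M j\<in>{..<d}. ext Qs j) (\<lambda>x. x j) \<and> (\<integral>x. x j \<partial>(\<Pi>\<^sub>M j\<in>{..<d}. ext Qs j)) = 0"
    have m0: "m j = 0" if "j < d" for j
      using cent that by (intro centered_shift_eq_0[OF nQ nQs sh]) auto
    show "(\<forall>j<d. C j = Cs j) \<and> (\<Pi>\<^sub>M j\<in>{..<d}. ext Q j) = (\<Pi>\<^sub>M j\<in>{..<d}. ext Qs j)"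
      using m m0 sh shift_measure_0[OF nQs, of d m] by simp
  qed
qed

end
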